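(* Let $d>6$ and let $G$ be a finite, simple, connected $d$-regular graph with $n$ vertices such that $G^2$ is not a complete graph. Suppose also that $G$ is neither a snake graph nor a peanut graph. Then $$e(G^2)-e(G) > 2n\left(1-\frac{2}{d+1}-\frac{3}{d-3}\right),$$ where $e(H)$ denotes the number of edges of a graph $H$.
   Context: For a graph $G$, $G^2$ is the graph on $V(G)$ in which $u\neq v$ are adjacent iff their distance in $G$ is at most $2$. Snake graph (defined only for odd $d$): Call a "B block" a vertex set $Q\cup\{u\}$ where $|Q|=d+1$, the induced graph on $Q$ is the complete graph $K_{d+1}$ with a perfect matching on a subset $P\subseteq Q$ of size $d-1$ removed, and $u$ is adjacent exactly to the vertices of $P$ within $Q\cup\{u\}$ (so $u$ has degree $d-1$ inside the block). Call a "segment" a vertex set $S$ with $|S|=d+1$ whose induced graph is $K_{d+1}$ minus one edge $ss'$ (the two endpoints $s,s'$ of the missing edge are its "ends"). A snake graph is a graph obtained from a B block $B_1$ (with special vertex $u_1$), segments $S_1,\dots,S_j$ ($j\ge 0$) and a second B block $B_2$ (with special vertex $u_2$), all vertex-disjoint, by adding exactly the following edges: if $j=0$ the edge $u_1u_2$; if $j\ge1$, an edge from $u_1$ to one end of $S_1$, an edge from the other end of $S_i$ to one end of $S_{i+1}$ for $1\le i\le j-1$, and an edge from the other end of $S_j$ to $u_2$. (Equivalently, two "tails" joined by an edge between their terminal vertices.) Peanut graph (defined only for even $d$): its vertex set is partitioned into $R_1$ with $|R_1|=d+1$ and $R_2$ with $|R_2|=d+2$. The only non-adjacent pair inside $R_1$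 is $\{w_1,w_2\}$. Inside $R_2$ there are distinct vertices $u,v_1,v_2,v_3$; the non-adjacent pairs inside $R_2$ are exactly $uv_1,uv_2,uv_3$ together with a perfect matching on $R_2\setminus\{u,v_1,v_2,v_3\}$. The only edges between $R_1$ and $R_2$ are $uw_1$ and $uw_2$. *)

theory Defs
  imports
    "Graph_Theory.Shortest_Path"
    "Graph_Theory.Kuratowski"
    "HOL-Library.Disjoint_Sets"
begin

text \<open>
  Finite simple graphs are the \<open>pair_graph\<close>s of \<open>Graph_Theory\<close>: finite, loop-free digraphs with a
  symmetric arc relation. Every edge therefore corresponds to two arcs, and the counting below is
  done on unordered pairs.
\<close>

definition edges :: "'a pair_pre_digraph \<Rightarrow> 'a set set" where
  "edges G = {{u, v} | u v. (u, v) \<in> parcs G}"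

definition num_edges :: "'a pair_pre_digraph \<Rightarrow> nat" where
  "num_edges G = card (edges G)"

definition regular :: "nat \<Rightarrow> 'a pair_pre_digraph \<Rightarrow> bool" where
  "regular d G \<longleftrightarrow> (\<forall>v\<in>pverts G. out_degree (with_proj G) v = d)"

definition distance :: "'a pair_pre_digraph \<Rightarrow> 'a \<Rightarrow> 'a \<Rightarrow> ereal" where
  "distance G u v = wf_digraph.\<mu> (with_proj G) (\<lambda>_. 1) u v"

definition square :: "'a pair_pre_digraph \<Rightarrow> 'a pair_pre_digraph" where
  "square G = \<lparr> pverts = pverts G,
     parcs = {(u, v). u \<in> pverts G \<and> v \<in> pverts G \<and> u \<noteq> v \<and> distance G u v \<le> 2} \<rparr>"

definition complete_graph :: "'a pair_pre_digraph \<Rightarrow> bool" where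
  "complete_graph G \<longleftrightarrow> complete_digraph (card (pverts G)) (with_proj G)"

definition all_pairs :: "'a set \<Rightarrow> 'a set set" where
  "all_pairs S = {e. e \<subseteq> S \<and> card e = 2}"

definition edges_within :: "'a pair_pre_digraph \<Rightarrow> 'a set \<Rightarrow> 'a set set" where
  "edges_within G S = {e \<in> edges G. e \<subseteq> S}"

definition perfect_matching_on :: "'a set \<Rightarrow> 'a set set \<Rightarrow> bool" where
  "perfect_matching_on P M \<longleftrightarrow> partition_on P M \<and> (\<forall>e\<in>M. card e = 2)"

text \<open>
  The next two predicates say that a vertex set \<open>S\<close> of \<open>G\<close> induces a B block with special
  vertex \<open>u\<close>, respectively a segment with ends \<open>s\<close> and \<open>s'\<close>.
\<close>

definition B_block :: "nat \<Rightarrow> 'a pair_pre_digraph \<Rightarrow> 'a set \<Rightarrow> 'a \<Rightarrow> bool" where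
  "B_block d G S u \<longleftrightarrow> (\<exists>Q P M.
     S = insert u Q \<and> u \<notin> Q \<and> card Q = d + 1 \<and>
     P \<subseteq> Q \<and> card P = d - 1 \<and> perfect_matching_on P M \<and>
     edges_within G Q = all_pairs Q - M \<and>
     {v \<in> S. {u, v} \<in> edges G} = P)"

definition segment :: "nat \<Rightarrow> 'a pair_pre_digraph \<Rightarrow> 'a set \<Rightarrow> 'a \<Rightarrow> 'a \<Rightarrow> bool" where
  "segment d G S s s' \<longleftrightarrow>
     card S = d + 1 \<and> s \<in> S \<and> s' \<in> S \<and> s \<noteq> s' \<and>
     edges_within G S = all_pairs S - {{s, s'}}"

text \<open>
  \<open>S 0\<close> and \<open>S (j + 1)\<close> are the two B blocks and \<open>S 1, \<dots>, S j\<close> the segments. Each part \<open>S i\<close> is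
  entered at \<open>a i\<close> and left at \<open>b i\<close>; in particular \<open>b 0\<close> and \<open>a (j + 1)\<close> are the special vertices
  of the B blocks, so that for \<open>j = 0\<close> the only linking edge joins these two.
\<close>

definition snake_graph :: "nat \<Rightarrow> 'a pair_pre_digraph \<Rightarrow> bool" where
  "snake_graph d G \<longleftrightarrow> odd d \<and> (\<exists>(j :: nat) S a b.
     B_block d G (S 0) (b 0) \<and>
     (\<forall>i\<in>{1..j}. segment d G (S i) (a i) (b i)) \<and>
     B_block d G (S (j + 1)) (a (j + 1)) \<and>
     disjoint_family_on S {0..j + 1} \<and>
     pverts G = (\<Union>i\<in>{0..j + 1}. S i) \<and>
     edges G = (\<Union>i\<in>{0..j + 1}. edges_within G (S i)) \<union> {{b i, a (i + 1)} | i. i \<le> j})"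

definition peanut_graph :: "nat \<Rightarrow> 'a pair_pre_digraph \<Rightarrow> bool" where
  "peanut_graph d G \<longleftrightarrow> even d \<and> (\<exists>R1 R2 w1 w2 u v1 v2 v3 M.
     pverts G = R1 \<union> R2 \<and> R1 \<inter> R2 = {} \<and> card R1 = d + 1 \<and> card R2 = d + 2 \<and>
     w1 \<in> R1 \<and> w2 \<in> R1 \<and> w1 \<noteq> w2 \<and>
     edges_within G R1 = all_pairs R1 - {{w1, w2}} \<and>
     {u, v1, v2, v3} \<subseteq> R2 \<and> distinct [u, v1, v2, v3] \<and>
     perfect_matching_on (R2 - {u, v1, v2, v3}) M \<and>
     edges_within G R2 = all_pairs R2 - ({{u, v1}, {u, v2}, {u, v3}} \<union> M) \<and>
     edges G = edges_within G R1 \<union> edges_within G R2 \<union> {{u, w1}, {u, w2}})"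

end

theory Submission
  imports Defs
begin

text \<open>
  Let \<open>N2 v\<close> be the set of vertices at distance \<open>2\<close> from \<open>v\<close>; then \<open>e(G\<^sup>2) - e(G)\<close> is half the sum
  of the \<open>card (N2 v)\<close>, so on average \<open>card (N2 v)\<close> has to be nearly \<open>4\<close>. If \<open>card (N2 v) \<le> 3\<close>, then
  \<open>N2 v\<close> separates the almost complete neighbourhood of \<open>v\<close> from the rest of the graph. For \<open>d \<ge> 9\<close>
  these dense parts can be chosen as disjoint blocks of at least \<open>d + 1\<close> vertices that contain all
  such \<open>v\<close>, and it suffices to lose at most \<open>20\<close> per block against the average \<open>4\<close>. A block \<open>H\<close> with
  \<open>card H = d + 1 + s\<close> and \<open>t\<close> boundary vertices has second degrees of about \<open>s + t\<close>, and a boundary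
  vertex with \<open>a\<close> neighbours in \<open>H\<close> and \<open>b\<close> neighbours far away adds \<open>a * b\<close> further pairs. Only B blocks and
  complete graphs minus an edge hanging on a single vertex fall short. They are compensated by the
  boundary vertex (for a B block: the vertex reached after a maximal run of segments), whose second
  neighbourhood contains \<open>d - 1\<close> vertices of the deficient part. That this vertex does not need these
  pairs for its own block fails only for snakes and peanuts, by parity of the number of edges
  leaving a block. For \<open>d \<le> 8\<close> the bound \<open>card (N2 v) \<ge> 1\<close> is enough.
\<close>

subsection \<open>Blocks around low vertices\<close>

text \<open>The allowance of \<open>20\<close> per block is \<open>4 * 5\<close>: four boundary
  vertices suffice, and each of them is within distance \<open>2\<close> of all but at most five
  vertices of the block, since a vertex of a block misses at most five others. At most
  \<open>n / (d + 1)\<close> blocks fit, and \<open>20 = 4 * 2 + 4 * 3\<close> matches the two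
  fractions of the claim.

  A boundary vertex adjacent to \<open>c\<close> is not at distance \<open>2\<close> from
  \<open>c\<close>, but every edge from \<open>c\<close> out of \<open>H\<close> makes
  \<open>c\<close> miss one more vertex of \<open>H\<close>; so second degrees reach
  \<open>s + t\<close> all the same.

  A demand costs \<open>d - 5\<close> because its payer sees at least \<open>d - 1\<close> vertices
  of the deficient part at distance \<open>2\<close> and, outside all blocks, has to keep four.

  The obstacle is double use: a payer inside a block must not spend pairs on which its own block
  relies. Pairs of the form \<open>a * b\<close> are therefore counted only at boundary vertices
  outside the claiming parts. A boundary vertex inside such a part has a single neighbour in
  \<open>H\<close>, and this makes parity decisive.\<close>

locale regular_graph =
  fixes V :: "'a set" and N :: "'a \<Rightarrow> 'a set" and d :: nat
  assumes finite_V: "finite V"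
    and N_subset: "N v \<subseteq> V"
    and N_irrefl: "v \<notin> N v"
    and N_sym: "u \<in> N v \<Longrightarrow> v \<in> N u"
    and card_N: "v \<in> V \<Longrightarrow> card (N v) = d"
    and cut: "A \<subseteq> V \<Longrightarrow> A \<noteq> {} \<Longrightarrow> A \<noteq> V \<Longrightarrow> \<exists>u\<in>A. \<exists>v\<in>V - A. v \<in> N u"
begin

definition N2 :: "'a \<Rightarrow> 'a set" where
  "N2 v = {w \<in> V. w \<noteq> v \<and> w \<notin> N v \<and> N v \<inter> N w \<noteq> {}}"

definition bd :: "'a set \<Rightarrow> 'a set" where
  "bd A = {z \<in> V. z \<notin> A \<and> N z \<inter> A \<noteq> {}}"

definition ball :: "'a \<Rightarrow> 'a set" where
  "ball v = insert v (N v)"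

text \<open>
  Second neighbours of a low vertex \<open>r\<close> with at most two neighbours beyond distance \<open>2\<close> from \<open>r\<close> are
  absorbed into the dense part around \<open>r\<close>; every other vertex of \<open>N2 r\<close> sees at least three.
\<close>

definition cluster :: "'a \<Rightarrow> 'a set" where
  "cluster r = ball r \<union> {x \<in> N2 r. card (N x - ball r - N2 r) \<le> 2}"

text \<open>This is the interface through which clusters are used. The bound \<open>d + 6\<close> is
  \<open>d + 1\<close> plus five: excess size and exits of a vertex sum to at most five, so it
  misses at most five vertices of \<open>H\<close>. The last two clauses supply far neighbours of
  boundary vertices for the cases in which excess and boundary together stay below four.\<close>

definition block :: "'a set \<Rightarrow> bool" where
  "block H \<longleftrightarrow> H \<subseteq> V \<and> d + 1 \<le> card H \<and>
     (\<forall>c\<in>H. \<forall>c'\<in>H. c \<noteq> c' \<longrightarrow> c' \<notin> N c \<longrightarrow> N c \<inter> N c' \<inter> H \<noteq> {}) \<and>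
     (\<forall>c\<in>H. card H + card (N c - H) \<le> d + 6) \<and> bd H \<noteq> {} \<and>
     (card H = d + 1 \<longrightarrow> card (bd H) \<le> 3 \<and> (\<forall>z\<in>bd H. 3 \<le> card (N z - H - bd H))) \<and>
     (card H + card (bd H) \<le> d + 4 \<longrightarrow> (\<forall>z\<in>bd H. 2 \<le> card (N z - H - bd H)))"

lemma finite_N [simp]: "finite (N v)"
  using N_subset finite_V finite_subset by blast

lemma finite_N2 [simp]: "finite (N2 v)"
  using finite_V by (simp add: N2_def)

lemma finite_bd [simp]: "finite (bd A)"
  using finite_V by (simp add: bd_def)

lemma finite_ball [simp]: "finite (ball v)"
  by (simp add: ball_def)

lemma finite_subset_V: "A \<subseteq> V \<Longrightarrow> finite A"
  using finite_V finite_subset by blast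

lemma N_in_V: "u \<in> N v \<Longrightarrow> u \<in> V"
  using N_subset by blast

lemma N_in_V': "u \<in> N v \<Longrightarrow> v \<in> V"
  using N_in_V N_sym by blast

lemma N_sym_iff: "u \<in> N v \<longleftrightarrow> v \<in> N u"
  using N_sym by blast

lemma N2_sym: "u \<in> N2 v \<Longrightarrow> v \<in> V \<Longrightarrow> v \<in> N2 u"
  using N_sym by (auto simp: N2_def)

lemma N2_in_V: "u \<in> N2 v \<Longrightarrow> u \<in> V"
  by (simp add: N2_def)

lemma card_ball: "v \<in> V \<Longrightarrow> card (ball v) = d + 1"
  by (simp add: ball_def N_irrefl card_N)

lemma bd_iff: "z \<in> bd A \<longleftrightarrow> z \<notin> A \<and> (\<exists>c\<in>A. c \<in> N z)"
  using N_in_V' by (auto simp: bd_def)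

lemma bd_I: "c \<in> A \<Longrightarrow> z \<in> N c \<Longrightarrow> z \<notin> A \<Longrightarrow> z \<in> bd A"
  using N_sym by (auto simp: bd_iff)

lemma bd_nonempty: "A \<subseteq> V \<Longrightarrow> A \<noteq> {} \<Longrightarrow> A \<noteq> V \<Longrightarrow> bd A \<noteq> {}"
  using cut[of A] bd_I by blast

lemma card_N_split: "v \<in> V \<Longrightarrow> card (N v \<inter> A) + card (N v - A) = d"
proof -
  assume "v \<in> V"
  have "card (N v) = card (N v \<inter> A) + card (N v - A)"
    by (subst card_Un_disjoint[symmetric]) (auto intro: arg_cong[where f=card])
  then show ?thesis using card_N[OF \<open>v \<in> V\<close>] by simp
qed

lemma card_missed:
  assumes "A \<subseteq> V" "c \<in> A"
  shows "card (A - N c - {c}) + d + 1 = card A + card (N c - A)"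
proof -
  have fin: "finite A" using assms finite_subset_V by blast
  have "A = insert c ((N c \<inter> A) \<union> (A - N c - {c}))" using assms N_irrefl by auto
  then have "card A = card (insert c ((N c \<inter> A) \<union> (A - N c - {c})))" by simp
  also have "\<dots> = Suc (card ((N c \<inter> A) \<union> (A - N c - {c})))"
    using fin N_irrefl by (subst card_insert_disjoint) auto
  also have "card ((N c \<inter> A) \<union> (A - N c - {c})) = card (N c \<inter> A) + card (A - N c - {c})"
    using fin by (subst card_Un_disjoint) auto
  finally show ?thesis using card_N_split[of c A] assms by auto
qed

lemma N_ball_subset: "c \<in> ball r \<Longrightarrow> r \<in> V \<Longrightarrow> N c \<subseteq> ball r \<union> N2 r"
  using N_sym N_in_V by (fastforce simp: ball_def N2_def)

lemma ball_Int_N2: "ball r \<inter> N2 r = {}"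
  by (auto simp: ball_def N2_def)

lemma ball_subset: "r \<in> V \<Longrightarrow> ball r \<subseteq> V"
  using N_subset by (auto simp: ball_def)

lemma cluster_subset: "r \<in> V \<Longrightarrow> cluster r \<subseteq> V"
  using ball_subset by (auto simp: cluster_def N2_def)

section \<open>The cluster around one low vertex\<close>

context
  fixes r assumes r: "r \<in> V" and low: "card (N2 r) \<le> 3"
begin

lemma card_cluster: "card (cluster r) = d + 1 + card {x \<in> N2 r. card (N x - ball r - N2 r) \<le> 2}"
  unfolding cluster_def using r ball_Int_N2[of r]
  by (subst card_Un_disjoint) (auto simp: card_ball)

lemma card_N2_diff:
  "card (N2 r - cluster r) + card {x \<in> N2 r. card (N x - ball r - N2 r) \<le> 2} = card (N2 r)"
proof -
  have "N2 r = (N2 r - cluster r) \<union> {x \<in> N2 r. card (N x - ball r - N2 r) \<le> 2}"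
    using ball_Int_N2[of r] by (auto simp: cluster_def)
  then have "card (N2 r) = card ((N2 r - cluster r) \<union> {x \<in> N2 r. card (N x - ball r - N2 r) \<le> 2})"
    by simp
  also have "\<dots> = card (N2 r - cluster r) + card {x \<in> N2 r. card (N x - ball r - N2 r) \<le> 2}"
    by (rule card_Un_disjoint) (auto simp: cluster_def)
  finally show ?thesis by simp
qed

lemma cluster_out:
  assumes c: "c \<in> cluster r"
  shows "card (N c - cluster r) \<le> card (N2 r - cluster r) + 2"
proof (cases "c \<in> ball r")
  case True
  then have "N c - cluster r \<subseteq> N2 r - cluster r"
    using N_ball_subset[OF True r] by (auto simp: cluster_def)
  then have "card (N c - cluster r) \<le> card (N2 r - cluster r)" by (intro card_mono) auto
  then show ?thesis by simp
next
  case False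
  with c have b: "card (N c - ball r - N2 r) \<le> 2" by (auto simp: cluster_def)
  have "N c - cluster r \<subseteq> (N2 r - cluster r) \<union> (N c - ball r - N2 r)"
    by (auto simp: cluster_def)
  then have "card (N c - cluster r) \<le> card ((N2 r - cluster r) \<union> (N c - ball r - N2 r))"
    by (intro card_mono) auto
  also have "\<dots> \<le> card (N2 r - cluster r) + card (N c - ball r - N2 r)" by (rule card_Un_le)
  finally show ?thesis using b by simp
qed

text \<open>A vertex of the ball loses at most the three vertices of \<open>N2 r\<close>. An
  absorbed vertex loses at most the two others of \<open>N2 r\<close> and two beyond.\<close>

lemma cluster_ball_nbrs:
  assumes c: "c \<in> cluster r"
  shows "d \<le> card (N c \<inter> ball r) + 4"
proof (cases "c \<in> ball r")
  case True
  have "N c - ball r \<subseteq> N2 r" using N_ball_subset[OF True r] by auto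
  then have "card (N c - ball r) \<le> card (N2 r)" by (intro card_mono) auto
  then show ?thesis using card_N_split[of c "ball r"] low cluster_subset[OF r] c by auto
next
  case False
  with c have b: "card (N c - ball r - N2 r) \<le> 2" and cX: "c \<in> N2 r" by (auto simp: cluster_def)
  have "N c - ball r \<subseteq> (N2 r - {c}) \<union> (N c - ball r - N2 r)" using N_irrefl by auto
  then have "card (N c - ball r) \<le> card ((N2 r - {c}) \<union> (N c - ball r - N2 r))"
    by (intro card_mono) auto
  also have "\<dots> \<le> card (N2 r - {c}) + card (N c - ball r - N2 r)" by (rule card_Un_le)
  also have "card (N2 r - {c}) \<le> 2" using low cX by (simp add: card_Diff_singleton)
  finally show ?thesis using b card_N_split[of c "ball r"] cluster_subset[OF r] c by auto
qed

lemma cluster_block: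
  assumes d: "9 \<le> d" and V: "V \<noteq> ball r \<union> N2 r"
  shows "block (cluster r)"
proof -
  let ?H = "cluster r" and ?X = "N2 r" and ?C = "ball r"
  let ?S = "{x \<in> N2 r. card (N x - ball r - N2 r) \<le> 2}"
  define s where "s = card ?S"
  have HV: "?H \<subseteq> V" by (rule cluster_subset[OF r])
  have finH: "finite ?H" using HV finite_subset_V by blast
  have cH: "card ?H = d + 1 + s" using card_cluster s_def by simp
  have ks: "card (?X - ?H) + s \<le> 3" using card_N2_diff low s_def by simp
  have out: "card (N c - ?H) + s \<le> 5" if "c \<in> ?H" for c
    using cluster_out[OF that] ks by simp
  have common: "N c \<inter> N c' \<inter> ?H \<noteq> {}"
    if c: "c \<in> ?H" "c' \<in> ?H" "c \<noteq> c'" "c' \<notin> N c" for c c'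
  proof (cases "c \<in> ?C \<and> c' \<in> ?C")
    case True
    then have "r \<in> N c \<inter> N c' \<inter> ?H"
      using c N_sym by (auto simp: ball_def cluster_def)
    then show ?thesis by auto
  next
    case False
    then have "?S \<noteq> {}" using c by (auto simp: cluster_def)
    then have s1: "s \<ge> 1" by (auto simp: s_def Suc_le_eq card_gt_0_iff)
    show ?thesis
    proof
      \<comment> \<open>Each of \<open>c\<close>, \<open>c'\<close> has at least
        \<open>d - 5 + s\<close> neighbours in \<open>?H\<close>. Disjoint sets of this size within
        the other \<open>d - 1 + s\<close> vertices would force \<open>d \<le> 9 - s\<close>,
        impossible as \<open>s \<ge> 1\<close> and \<open>d \<ge> 9\<close>.\<close>
      assume e: "N c \<inter> N c' \<inter> ?H = {}"
      have "card ((N c \<inter> ?H) \<union> (N c' \<inter> ?H)) = card (N c \<inter> ?H) + card (N c' \<inter> ?H)"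
        using e by (subst card_Un_disjoint) auto
      moreover have "card ((N c \<inter> ?H) \<union> (N c' \<inter> ?H)) \<le> card (?H - {c, c'})"
        using finH c N_irrefl N_sym by (intro card_mono) auto
      moreover have "card (?H - {c, c'}) + 2 = card ?H"
      proof -
        have "card {c, c'} \<le> card ?H" by (rule card_mono) (use c finH in auto)
        then show ?thesis using c finH by (subst card_Diff_subset) auto
      qed
      ultimately have "card (N c \<inter> ?H) + card (N c' \<inter> ?H) + 2 \<le> d + 1 + s" using cH by simp
      moreover have "card (N c \<inter> ?H) + card (N c - ?H) = d" "card (N c' \<inter> ?H) + card (N c' - ?H) = d"
        using card_N_split c HV by auto
      ultimately show False using cluster_out[OF c(1)] cluster_out[OF c(2)] ks s1 d by linarith
    qed
  qed
  have "?H \<noteq> V" using V ball_subset[OF r] by (auto simp: cluster_def N2_def)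
  moreover have "?H \<noteq> {}" by (auto simp: cluster_def ball_def)
  ultimately have bd: "bd ?H \<noteq> {}" using bd_nonempty HV by blast
  have bd_N: "N z \<inter> ?H \<subseteq> ?S" if "z \<notin> ?C" "z \<notin> ?X" for z
  proof
    fix c assume "c \<in> N z \<inter> ?H"
    moreover have "c \<notin> ?C" using that N_ball_subset[of c r] r N_sym calculation by blast
    ultimately show "c \<in> ?S" by (auto simp: cluster_def)
  qed
  have far: "3 \<le> card (N z - ?C - ?X)" if "z \<in> bd ?H" "z \<in> ?X" for z
    using that by (auto simp: bd_def cluster_def)
  have A: "card (bd ?H) \<le> 3 \<and> (\<forall>z\<in>bd ?H. 3 \<le> card (N z - ?H - bd ?H))" if "card ?H = d + 1"
  proof -
    have "s = 0" using that cH by simp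
    then have "?S = {}" by (auto simp: s_def)
    then have HC: "?H = ?C" unfolding cluster_def by blast
    have bX: "bd ?H \<subseteq> ?X" using HC bd_N \<open>?S = {}\<close> by (auto simp: bd_def)
    then have "card (bd ?H) \<le> card ?X" by (intro card_mono) auto
    moreover have "3 \<le> card (N z - ?H - bd ?H)" if "z \<in> bd ?H" for z
    proof -
      have "N z - ?C - ?X \<subseteq> N z - ?H - bd ?H" using HC bX by auto
      then have "card (N z - ?C - ?X) \<le> card (N z - ?H - bd ?H)" by (intro card_mono) auto
      then show ?thesis using far[of z] that bX by auto
    qed
    ultimately show ?thesis using low by auto
  qed
  have B: "2 \<le> card (N z - ?H - bd ?H)" if t: "card ?H + card (bd ?H) \<le> d + 4" and z: "z \<in> bd ?H" for z
  proof (cases "s = 0")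
    case True
    then have "3 \<le> card (N z - ?H - bd ?H)" using A cH z by simp
    then show ?thesis by simp
  next
    case False
    have st: "s + card (bd ?H) \<le> 3" using t cH by simp
    have bz: "card (bd ?H - {z}) \<le> 2 - s"
      using z st by (simp add: card_Diff_singleton)
    show ?thesis
    proof (cases "z \<in> ?X")
      case True
      have "N z - ?C - ?X - (bd ?H - {z}) \<subseteq> N z - ?H - bd ?H" using N_irrefl by (auto simp: cluster_def)
      then have "card (N z - ?C - ?X - (bd ?H - {z})) \<le> card (N z - ?H - bd ?H)"
        by (intro card_mono) auto
      moreover have "card (N z - ?C - ?X) - card (bd ?H - {z}) \<le> card (N z - ?C - ?X - (bd ?H - {z}))"
        by (rule diff_card_le_card_Diff) simp
      ultimately show ?thesis using far[OF z True] bz False by linarith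
    next
      case F: False
      have zC: "z \<notin> ?C" using z by (auto simp: bd_def cluster_def)
      \<comment> \<open>Beyond \<open>N2 r\<close>, a boundary vertex meets \<open>?H\<close> only
        in absorbed vertices, so all but at most two of its \<open>d\<close> neighbours are
        far.\<close>
      have "N z - (?S \<union> (bd ?H - {z})) \<subseteq> N z - ?H - bd ?H"
        using bd_N[OF zC F] N_irrefl by auto
      then have "card (N z - (?S \<union> (bd ?H - {z}))) \<le> card (N z - ?H - bd ?H)"
        by (intro card_mono) auto
      moreover have "card (N z) - card (?S \<union> (bd ?H - {z})) \<le> card (N z - (?S \<union> (bd ?H - {z})))"
        by (rule diff_card_le_card_Diff) simp
      moreover have "card (?S \<union> (bd ?H - {z})) \<le> s + card (bd ?H - {z})"
        unfolding s_def by (rule card_Un_le)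
      moreover have "card (N z) = d" using z by (auto simp: bd_def card_N)
      ultimately show ?thesis using bz d st by linarith
    qed
  qed
  have common': "\<forall>c\<in>?H. \<forall>c'\<in>?H. c \<noteq> c' \<longrightarrow> c' \<notin> N c \<longrightarrow> N c \<inter> N c' \<inter> ?H \<noteq> {}"
    by (intro ballI impI common)
  have out': "\<forall>c\<in>?H. card ?H + card (N c - ?H) \<le> d + 6"
    using out unfolding cH by fastforce
  have dH: "d + 1 \<le> card ?H" using cH by simp
  have A': "card ?H = d + 1 \<longrightarrow> card (bd ?H) \<le> 3 \<and> (\<forall>z\<in>bd ?H. 3 \<le> card (N z - ?H - bd ?H))"
    using A by (rule impI)
  have B': "card ?H + card (bd ?H) \<le> d + 4 \<longrightarrow> (\<forall>z\<in>bd ?H. 2 \<le> card (N z - ?H - bd ?H))"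
    by (intro impI ballI B)
  show ?thesis unfolding block_def
    by (rule conjI[OF HV conjI[OF dH conjI[OF common' conjI[OF out' conjI[OF bd conjI[OF A' B']]]]]])
qed

end

text \<open>The balls of centres more than \<open>2\<close> apart are disjoint, and a common member
  of the clusters would have \<open>d - 4\<close> neighbours in each. The inequality
  \<open>2 * (d - 4) \<le> d\<close> fails exactly from \<open>d = 9\<close> on, which is one source
  of that threshold.\<close>

lemma clusters_disjoint:
  assumes "r \<in> V" "card (N2 r) \<le> 3" "r' \<in> V" "card (N2 r') \<le> 3" "9 \<le> d" "r' \<notin> ball r \<union> N2 r"
  shows "cluster r \<inter> cluster r' = {}"
proof (rule ccontr)
  assume "cluster r \<inter> cluster r' \<noteq> {}"
  then obtain w where w: "w \<in> cluster r" "w \<in> cluster r'" by auto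
  have e: "ball r \<inter> ball r' = {}"
  proof (rule ccontr)
    assume "ball r \<inter> ball r' \<noteq> {}"
    then obtain c where c: "c \<in> ball r" "c \<in> ball r'" by blast
    have "r' = c \<or> r' \<in> N c" using c(2) N_sym by (auto simp: ball_def)
    then show False using c(1) assms(6) N_ball_subset[OF c(1) assms(1)] by blast
  qed
  have "card (N w \<inter> ball r) + card (N w \<inter> ball r') = card ((N w \<inter> ball r) \<union> (N w \<inter> ball r'))"
    using e by (subst card_Un_disjoint) auto
  also have "\<dots> \<le> card (N w)" by (intro card_mono) auto
  also have "card (N w) = d" using w cluster_subset assms card_N by blast
  finally show False
    using cluster_ball_nbrs[of r w] cluster_ball_nbrs[of r' w] assms w by linarith
qed

text \<open>A bootstrap for low \<open>u\<close> in \<open>N2 r\<close>: one common neighbour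
  \<open>c\<close> already yields four neighbours of \<open>u\<close> in the ball. A vertex of the
  ball misses at most three others there, so it shares one of the four with \<open>u\<close>. Hence
  every ball vertex not adjacent to \<open>u\<close> lies in \<open>N2 u\<close>; there are at most
  three, so \<open>u\<close> has at least \<open>d - 2\<close> neighbours in the ball and at most
  two outside. This is where the threshold \<open>2\<close> in \<open>cluster\<close> comes
  from.\<close>

lemma low_in_cluster:
  assumes r: "r \<in> V" "card (N2 r) \<le> 3" and u: "card (N2 u) \<le> 3" "u \<in> ball r \<union> N2 r" and d: "9 \<le> d"
  shows "u \<in> cluster r"
proof (cases "u \<in> ball r")
  case True
  then show ?thesis by (simp add: cluster_def)
next
  case False
  then have uX: "u \<in> N2 r" using u by simp
  then have uV: "u \<in> V" by (rule N2_in_V)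
  have out: "card (N p - ball r) \<le> 3" if "p \<in> ball r" for p
  proof -
    have "card (N p - ball r) \<le> card (N2 r)"
      using N_ball_subset[OF that] r by (intro card_mono) auto
    then show ?thesis using r by simp
  qed
  have in_ball: "card (N p \<inter> ball r) \<ge> d - 3" if "p \<in> ball r" for p
    using out[OF that] card_N_split[of p "ball r"] that ball_subset[of r] r by auto
  obtain c where c: "c \<in> ball r" "c \<in> N u"
    using uX by (auto simp: N2_def ball_def)
  have "N c \<inter> ball r - N u \<subseteq> N2 u"
    using c uV False N_sym N_in_V unfolding N2_def by blast
  then have "card (N c \<inter> ball r - N u) \<le> 3" using u(1) card_mono[OF finite_N2] order_trans by blast
  moreover have "card (N c \<inter> ball r) \<le> card ((N c \<inter> ball r - N u) \<union> (N c \<inter> ball r \<inter> N u))"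
    by (intro card_mono) auto
  ultimately have "card (N c \<inter> ball r \<inter> N u) \<ge> d - 6"
    using in_ball[OF c(1)] card_Un_le[of "N c \<inter> ball r - N u" "N c \<inter> ball r \<inter> N u"] by linarith
  \<comment> \<open>Strict because of \<open>c\<close> itself; this extra neighbour raises
    \<open>d - 6\<close> to \<open>d - 5 \<ge> 4\<close>.\<close>
  moreover have "card (N c \<inter> ball r \<inter> N u) < card (N u \<inter> ball r)"
    by (intro psubset_card_mono) (use c N_irrefl in auto)
  ultimately have a: "card (N u \<inter> ball r) \<ge> 4" using d by linarith
  have "ball r - N u \<subseteq> N2 u"
  proof
    fix p assume p: "p \<in> ball r - N u"
    have pV: "p \<in> V" using p ball_subset r by auto
    have "N u \<inter> N p \<noteq> {}"
    proof
      assume "N u \<inter> N p = {}"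
      then have "N u \<inter> ball r \<subseteq> ball r - N p - {p}" using p N_sym by auto
      then have "card (N u \<inter> ball r) \<le> card (ball r - N p - {p})" by (intro card_mono) auto
      moreover have "card (ball r - N p - {p}) + d + 1 = card (ball r) + card (N p - ball r)"
        using card_missed ball_subset r p by auto
      ultimately show False using a out[of p] p card_ball r by auto
    qed
    then show "p \<in> N2 u" using p pV False by (auto simp: N2_def)
  qed
  then have "card (ball r - N u) \<le> 3" using u(1) card_mono[OF finite_N2] order_trans by blast
  moreover have "card (ball r) \<le> card ((ball r - N u) \<union> (N u \<inter> ball r))" by (intro card_mono) auto
  ultimately have "card (N u \<inter> ball r) \<ge> d - 2"
    using card_Un_le[of "ball r - N u" "N u \<inter> ball r"] card_ball[of r] r by linarith
  then have "card (N u - ball r) \<le> 2" using card_N_split[OF uV, of "ball r"] d by linarith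
  moreover have "card (N u - ball r - N2 r) \<le> card (N u - ball r)" by (intro card_mono) auto
  ultimately show ?thesis using uX by (simp add: cluster_def)
qed

text \<open>The centres form a maximal set of low vertices pairwise more than \<open>2\<close>
  apart. Distance keeps the clusters disjoint, and maximality puts every low vertex within
  \<open>2\<close> of a centre, where \<open>low_in_cluster\<close> applies.\<close>

lemma exists_block_family:
  assumes d: "9 \<le> d" and V: "\<And>r. r \<in> V \<Longrightarrow> card (N2 r) \<le> 3 \<Longrightarrow> V \<noteq> ball r \<union> N2 r"
  shows "\<exists>\<B>. (\<forall>H\<in>\<B>. block H) \<and> disjoint \<B> \<and> (\<forall>u\<in>V. card (N2 u) \<le> 3 \<longrightarrow> u \<in> \<Union>\<B>)"
proof -
  define L where "L = {r \<in> V. card (N2 r) \<le> 3}"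
  define good where "good R \<longleftrightarrow> R \<subseteq> L \<and> (\<forall>r\<in>R. \<forall>r'\<in>R. r \<noteq> r' \<longrightarrow> r' \<notin> ball r \<union> N2 r)" for R
  have finL: "finite L" using finite_V by (simp add: L_def)
  have fin: "finite {R. good R}" by (rule finite_subset[of _ "Pow L"]) (auto simp: good_def finL)
  have "good {}" by (simp add: good_def)
  then obtain R where R: "good R" "\<And>R'. good R' \<Longrightarrow> R \<subseteq> R' \<Longrightarrow> R = R'"
    using finite_has_maximal[OF fin] by auto
  have RL: "r \<in> V" "card (N2 r) \<le> 3" if "r \<in> R" for r using R(1) that by (auto simp: good_def L_def)
  have "disjoint (cluster ` R)"
  proof (rule disjointI)
    fix a b assume "a \<in> cluster ` R" "b \<in> cluster ` R" "a \<noteq> b"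
    then obtain r r' where "r \<in> R" "r' \<in> R" "r \<noteq> r'" "a = cluster r" "b = cluster r'" by auto
    then show "a \<inter> b = {}" using clusters_disjoint[of r r'] RL d R(1) by (auto simp: good_def)
  qed
  moreover have "u \<in> \<Union>(cluster ` R)" if u: "u \<in> V" "card (N2 u) \<le> 3" for u
  proof (cases "u \<in> R")
    case True
    then show ?thesis by (auto simp: cluster_def ball_def)
  next
    case False
    have "\<not> good (insert u R)" using R(2)[of "insert u R"] False by auto
    moreover have "u \<in> L" using u by (simp add: L_def)
    ultimately obtain r where r: "r \<in> R" "u \<in> ball r \<union> N2 r \<or> r \<in> ball u \<union> N2 u"
      using R(1) by (auto simp: good_def)
    then have "u \<in> ball r \<union> N2 r"
      using N2_sym[OF _ u(1)] N_sym by (auto simp: ball_def)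
    then show ?thesis using low_in_cluster[of r u] RL[OF r(1)] u d r(1) by auto
  qed
  moreover have "block H" if "H \<in> cluster ` R" for H
    using that cluster_block RL V d by auto
  ultimately show ?thesis by (intro exI[of _ "cluster ` R"]) auto
qed

end

subsection \<open>Second neighbourhoods of blocks\<close>

lemma double_count:
  assumes "finite A" "finite B"
  shows "(\<Sum>a\<in>A. card {b \<in> B. R a b}) = (\<Sum>b\<in>B. card {a \<in> A. R a b})"
proof -
  have "(\<Sum>a\<in>A. card {b \<in> B. R a b}) = (\<Sum>a\<in>A. \<Sum>b\<in>B. if R a b then 1 else 0)"
    using assms by (intro sum.cong) (simp_all add: sum.If_cases Int_def)
  also have "\<dots> = (\<Sum>b\<in>B. \<Sum>a\<in>A. if R a b then 1 else 0)" by (rule sum.swap)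
  also have "\<dots> = (\<Sum>b\<in>B. card {a \<in> A. R a b})"
    using assms by (intro sum.cong) (simp_all add: sum.If_cases Int_def)
  finally show ?thesis .
qed

context regular_graph
begin

text \<open>Handshake lemma: a new vertex contributes its degree into \<open>A\<close> twice, in its
  own term and spread over the terms of its neighbours.\<close>

lemma even_inner_degrees: "finite A \<Longrightarrow> even (\<Sum>c\<in>A. card (N c \<inter> A))"
proof (induction A rule: finite_induct)
  case empty
  then show ?case by simp
next
  case (insert x A)
  have "card (N c \<inter> insert x A) = card (N c \<inter> A) + card {b \<in> {x}. b \<in> N c}" if "c \<in> A" for c
  proof -
    have "N c \<inter> insert x A = (N c \<inter> A) \<union> {b \<in> {x}. b \<in> N c}" by auto
    also have "card \<dots> = card (N c \<inter> A) + card {b \<in> {x}. b \<in> N c}"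
      using insert.hyps by (intro card_Un_disjoint) auto
    finally show ?thesis .
  qed
  then have "(\<Sum>c\<in>A. card (N c \<inter> insert x A)) =
      (\<Sum>c\<in>A. card (N c \<inter> A)) + (\<Sum>c\<in>A. card {b \<in> {x}. b \<in> N c})"
    by (simp add: sum.distrib)
  also have "(\<Sum>c\<in>A. card {b \<in> {x}. b \<in> N c}) = card {c \<in> A. x \<in> N c}"
    using double_count[OF insert.hyps(1), of "{x}" "\<lambda>c b. b \<in> N c"] by simp
  also have "{c \<in> A. x \<in> N c} = N x \<inter> insert x A" using N_sym N_irrefl by auto
  finally show ?case using insert by simp
qed

lemma exits_count:
  assumes "A \<subseteq> V"
  shows "(\<Sum>c\<in>A. card (N c - A)) = (\<Sum>z\<in>bd A. card (N z \<inter> A))"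
proof -
  have "(\<Sum>c\<in>A. card (N c - A)) = (\<Sum>c\<in>A. card {z \<in> bd A. z \<in> N c})"
  proof (intro sum.cong arg_cong[where f=card] refl)
    fix c assume "c \<in> A"
    then show "N c - A = {z \<in> bd A. z \<in> N c}" using bd_I[of c A] by (auto simp: bd_def)
  qed
  also have "\<dots> = (\<Sum>z\<in>bd A. card {c \<in> A. z \<in> N c})"
    using assms finite_subset_V by (intro double_count) auto
  also have "\<dots> = (\<Sum>z\<in>bd A. card (N z \<inter> A))"
    using N_sym by (intro sum.cong arg_cong[where f=card]) auto
  finally show ?thesis .
qed

lemma exits_parity:
  assumes "A \<subseteq> V"
  shows "even (d * card A + (\<Sum>z\<in>bd A. card (N z \<inter> A)))"
proof -
  have "(\<Sum>c\<in>A. card (N c \<inter> A)) + (\<Sum>c\<in>A. card (N c - A)) = (\<Sum>c\<in>A. d)"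
    using assms by (subst sum.distrib[symmetric], intro sum.cong) (auto simp: card_N_split)
  then have "d * card A = (\<Sum>c\<in>A. card (N c \<inter> A)) + (\<Sum>z\<in>bd A. card (N z \<inter> A))"
    using exits_count[OF assms] by (simp add: mult.commute)
  then show ?thesis using even_inner_degrees[of A] assms finite_subset_V by simp
qed

lemma block_subset: "block H \<Longrightarrow> H \<subseteq> V"
  by (simp add: block_def)

lemma block_missed_le:
  assumes "block H" "c \<in> H"
  shows "card (H - N c - {c}) \<le> 5"
  using card_missed[OF block_subset[OF assms(1)] assms(2)] assms unfolding block_def by fastforce

text \<open>In \<open>H\<close> the vertex \<open>c\<close> misses its excess
  \<open>card H - (d + 1)\<close> plus one vertex per exit, and all missed vertices are second
  neighbours. The surplus from the exits stands in for the adjacent boundary vertices, so every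
  boundary vertex near \<open>c\<close> may be counted. Choosing \<open>T\<close> instead of all of
  \<open>bd H\<close> keeps the error \<open>5 * card T\<close> small when the boundary is
  large.\<close>

lemma block_ineq:
  assumes H: "block H" and T: "T \<subseteq> bd H"
  shows "(card H - (d + 1) + card T) * card H + (\<Sum>c\<in>H. card (N2 c - H - bd H))
    \<le> (\<Sum>c\<in>H. card (N2 c)) + 5 * card T"
proof -
  have HV: "H \<subseteq> V" and finH: "finite H" using block_subset[OF H] finite_subset_V by auto
  have finT: "finite T" using T finite_bd finite_subset by blast
  let ?near = "\<lambda>c z. z \<in> N c \<or> z \<in> N2 c"
  have 1: "card H - (d + 1) + card {z \<in> T. ?near c z} + card (N2 c - H - bd H) \<le> card (N2 c)"
    if c: "c \<in> H" for c
  proof -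
    have "H - N c - {c} \<subseteq> N2 c \<inter> H"
      using H c unfolding block_def N2_def by fastforce
    then have a: "card (H - N c - {c}) \<le> card (N2 c \<inter> H)" by (intro card_mono) auto
    have b: "card (N2 c) = card (N2 c \<inter> H) + card (N2 c \<inter> bd H) + card (N2 c - H - bd H)"
    proof -
      have "N2 c = (N2 c \<inter> H) \<union> (N2 c \<inter> bd H) \<union> (N2 c - H - bd H)" by auto
      then have "card (N2 c) = card ((N2 c \<inter> H) \<union> (N2 c \<inter> bd H) \<union> (N2 c - H - bd H))" by simp
      also have "\<dots> = card ((N2 c \<inter> H) \<union> (N2 c \<inter> bd H)) + card (N2 c - H - bd H)"
        by (intro card_Un_disjoint) auto
      also have "card ((N2 c \<inter> H) \<union> (N2 c \<inter> bd H)) = card (N2 c \<inter> H) + card (N2 c \<inter> bd H)"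
        by (intro card_Un_disjoint) (auto simp: bd_def)
      finally show ?thesis .
    qed
    have "card {z \<in> T. ?near c z} \<le> card ((N c - H) \<union> (N2 c \<inter> bd H))"
      using T by (intro card_mono) (auto simp: bd_def)
    also have "\<dots> \<le> card (N c - H) + card (N2 c \<inter> bd H)" by (rule card_Un_le)
    finally have "card {z \<in> T. ?near c z} \<le> card (N c - H) + card (N2 c \<inter> bd H)" .
    moreover have "d + 1 \<le> card H" using H by (simp add: block_def)
    ultimately show ?thesis using a b card_missed[OF HV c] by linarith
  qed
  \<comment> \<open>Every neighbour of a contact \<open>c0\<close> is within distance
    \<open>2\<close> of \<open>z\<close>; only vertices missed by \<open>c0\<close> can
    fail.\<close>
  have 2: "card H \<le> card {c \<in> H. ?near c z} + 5" if z: "z \<in> T" for z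
  proof -
    obtain c0 where c0: "c0 \<in> H" "c0 \<in> N z" using z T by (auto simp: bd_def)
    have "H - {c \<in> H. ?near c z} \<subseteq> H - N c0 - {c0}"
    proof
      fix c assume c: "c \<in> H - {c \<in> H. ?near c z}"
      have "z \<in> V" "z \<notin> H" using z T by (auto simp: bd_def)
      moreover have "z \<in> N c" if "c = c0" using that c0 N_sym by blast
      moreover have "c0 \<in> N c \<inter> N z" if "c \<in> N c0" using that c0 N_sym by blast
      ultimately show "c \<in> H - N c0 - {c0}" using c unfolding N2_def by auto
    qed
    then have "card (H - {c \<in> H. ?near c z}) \<le> card (H - N c0 - {c0})"
      using finH by (intro card_mono) auto
    also have "\<dots> \<le> 5" by (rule block_missed_le[OF H c0(1)])
    finally have "card (H - {c \<in> H. ?near c z}) \<le> 5" .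
    moreover have "card (H - {c \<in> H. ?near c z}) = card H - card {c \<in> H. ?near c z}"
      using finH by (intro card_Diff_subset) auto
    ultimately show ?thesis by linarith
  qed
  have "card T * card H = (\<Sum>z\<in>T. card H)" by simp
  also have "\<dots> \<le> (\<Sum>z\<in>T. card {c \<in> H. ?near c z} + 5)" by (intro sum_mono 2)
  also have "\<dots> = (\<Sum>c\<in>H. card {z \<in> T. ?near c z}) + 5 * card T"
    by (simp add: sum.distrib double_count[OF finH finT])
  finally have 3: "card T * card H \<le> (\<Sum>c\<in>H. card {z \<in> T. ?near c z}) + 5 * card T" .
  have "(\<Sum>c\<in>H. card H - (d + 1) + card {z \<in> T. ?near c z} + card (N2 c - H - bd H))
      \<le> (\<Sum>c\<in>H. card (N2 c))"
    by (intro sum_mono 1)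
  then have "card H * (card H - (d + 1)) + (\<Sum>c\<in>H. card {z \<in> T. ?near c z})
      + (\<Sum>c\<in>H. card (N2 c - H - bd H)) \<le> (\<Sum>c\<in>H. card (N2 c))"
    by (simp add: sum.distrib)
  moreover have "(card H - (d + 1) + card T) * card H = card H * (card H - (d + 1)) + card T * card H"
    by (simp add: algebra_simps)
  ultimately show ?thesis using 3 by linarith
qed

text \<open>
  The three kinds of blocks that need a special treatment: \<open>typeA\<close> is the part \<open>R1\<close> of a peanut,
  \<open>typeB\<close> a B block and \<open>seg\<close> a segment. In a block the degrees determine the induced graph from
  these numbers, as a vertex \<open>c\<close> misses exactly \<open>card H - (d + 1) + card (N c - H)\<close> others.
\<close>

definition typeA :: "'a set \<Rightarrow> bool" where
  "typeA H \<longleftrightarrow> card H = d + 1 \<and> card (bd H) = 1 \<and> (\<forall>z\<in>bd H. card (N z \<inter> H) = 2)"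

definition typeB :: "'a set \<Rightarrow> bool" where
  "typeB H \<longleftrightarrow> card H = d + 2 \<and> card (bd H) = 1 \<and> (\<forall>z\<in>bd H. card (N z \<inter> H) = 1)"

definition seg :: "'a set \<Rightarrow> bool" where
  "seg H \<longleftrightarrow> card H = d + 1 \<and> card (bd H) = 2 \<and> (\<forall>z\<in>bd H. card (N z \<inter> H) = 1)"

section \<open>Exits of the special blocks\<close>

lemma out_subset_bd: "c \<in> H \<Longrightarrow> N c - H \<subseteq> bd H"
  using bd_I by blast

text \<open>At size \<open>d + 1\<close> a vertex misses as many others as it has exits, and missing
  is symmetric. So no single vertex of \<open>H\<close> can carry all exits.\<close>

lemma missed_has_exit:
  assumes "H \<subseteq> V" "card H = d + 1" "c \<in> H" "\<not> N c \<subseteq> H"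
  shows "\<exists>p\<in>H. p \<noteq> c \<and> p \<notin> N c \<and> \<not> N p \<subseteq> H"
proof -
  have "card (N c - H) \<noteq> 0" using assms(4) by auto
  then have "card (H - N c - {c}) \<noteq> 0" using card_missed[OF assms(1,3)] assms(2) by linarith
  then have "H - N c - {c} \<noteq> {}" by (metis card.empty)
  then obtain p where p: "p \<in> H" "p \<noteq> c" "p \<notin> N c" by blast
  then have "c \<in> H - N p - {p}" using assms(3) N_sym by auto
  then have "card (H - N p - {p}) \<noteq> 0" using assms(1) finite_subset_V by auto
  then have "card (N p - H) \<noteq> 0" using card_missed[OF assms(1) p(1)] assms(2) by linarith
  then have "\<not> N p \<subseteq> H" by (metis Diff_eq_empty_iff card.empty)
  then show ?thesis using p by blast
qed

lemma seg_ends: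
  assumes "H \<subseteq> V" "seg H"
  obtains c c' z z' where "c \<in> H" "c' \<in> H" "c \<noteq> c'" "z \<noteq> z'" "bd H = {z, z'}"
    "N c - H = {z}" "N c' - H = {z'}" "N z \<inter> H = {c}" "N z' \<inter> H = {c'}" "\<forall>p\<in>H - {c, c'}. N p \<subseteq> H"
proof -
  obtain z z' where z: "bd H = {z, z'}" "z \<noteq> z'"
    using assms(2) by (auto simp: seg_def card_2_iff)
  obtain c where c: "N z \<inter> H = {c}" using assms(2) z by (auto simp: seg_def card_1_singleton_iff)
  obtain c' where c': "N z' \<inter> H = {c'}" using assms(2) z by (auto simp: seg_def card_1_singleton_iff)
  have out: "p = c \<and> y = z \<or> p = c' \<and> y = z'" if "p \<in> H" "y \<in> N p" "y \<notin> H" for p y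
  proof -
    have "y \<in> bd H" using bd_I that by blast
    moreover have "p \<in> N y \<inter> H" using that N_sym by blast
    ultimately show ?thesis using z c c' by auto
  qed
  have "c \<in> H" "c' \<in> H" "z \<in> N c" "z' \<in> N c'" "z \<notin> H" "z' \<notin> H"
    using c c' N_sym z by (auto simp: bd_def)
  moreover have "c \<noteq> c'"
  proof
    assume "c = c'"
    obtain p where "p \<in> H" "p \<noteq> c" "\<not> N p \<subseteq> H"
      using missed_has_exit[of H c] assms \<open>c \<in> H\<close> \<open>z \<in> N c\<close> \<open>z \<notin> H\<close> by (auto simp: seg_def)
    then show False using out \<open>c = c'\<close> by blast
  qed
  ultimately show ?thesis
    by (intro that[of c c' z z']) (use z c c' out in blast)+
qed

lemma typeB_ends:
  assumes "typeB H"
  obtains u z where "u \<in> H" "bd H = {z}" "N u - H = {z}" "N z \<inter> H = {u}" "\<forall>p\<in>H - {u}. N p \<subseteq> H"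
proof -
  obtain z where z: "bd H = {z}"
    using assms by (auto simp: typeB_def card_1_singleton_iff)
  obtain u where u: "N z \<inter> H = {u}" using assms z by (auto simp: typeB_def card_1_singleton_iff)
  have out: "p = u \<and> y = z" if "p \<in> H" "y \<in> N p" "y \<notin> H" for p y
  proof -
    have "y \<in> bd H" using bd_I that by blast
    moreover have "p \<in> N y \<inter> H" using that N_sym by blast
    ultimately show ?thesis using z u by auto
  qed
  have "u \<in> H" "z \<in> N u" "z \<notin> H"
    using u N_sym z by (auto simp: bd_def)
  then show ?thesis
    by (intro that[of u z]) (use z u out in blast)+
qed

lemma typeA_ends:
  assumes "H \<subseteq> V" "typeA H"
  obtains w w' z where "w \<in> H" "w' \<in> H" "w \<noteq> w'" "w' \<notin> N w" "bd H = {z}" "N w - H = {z}" "N w' - H = {z}"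
    "N z \<inter> H = {w, w'}" "\<forall>p\<in>H - {w, w'}. N p \<subseteq> H"
proof -
  obtain z where z: "bd H = {z}"
    using assms by (auto simp: typeA_def card_1_singleton_iff)
  obtain w w' where w: "N z \<inter> H = {w, w'}" "w \<noteq> w'"
    using assms z by (auto simp: typeA_def card_2_iff)
  have out: "(p = w \<or> p = w') \<and> y = z" if "p \<in> H" "y \<in> N p" "y \<notin> H" for p y
  proof -
    have "y \<in> bd H" using bd_I that by blast
    moreover have "p \<in> N y \<inter> H" using that N_sym by blast
    ultimately show ?thesis using z w by auto
  qed
  have *: "w \<in> H" "w' \<in> H" "z \<in> N w" "z \<in> N w'" "z \<notin> H"
    using w N_sym z by (auto simp: bd_def)
  moreover have "w' \<notin> N w"
  proof -
    obtain p where "p \<in> H" "p \<noteq> w" "p \<notin> N w" "\<not> N p \<subseteq> H"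
      using missed_has_exit[of H w] assms * by (auto simp: typeA_def)
    then show ?thesis using out by blast
  qed
  ultimately show ?thesis
    by (intro that[of w w' z]) (use z w out in blast)+
qed

text \<open>The only exit makes \<open>d * (d + 2) + 1\<close> even.\<close>

lemma typeB_odd: "H \<subseteq> V \<Longrightarrow> typeB H \<Longrightarrow> odd d"
  using exits_parity[of H] by (auto simp: typeB_def card_1_singleton_iff)

end

subsection \<open>Tails and demands\<close>

context regular_graph
begin

definition exit :: "'a set \<Rightarrow> 'a \<Rightarrow> bool" where
  "exit A u \<longleftrightarrow> u \<in> A \<and> \<not> N u \<subseteq> A"

text \<open>The outgoing end \<open>b j\<close> stays open, so that the sequence can be continued by
  a further part.\<close>

definition links :: "nat \<Rightarrow> (nat \<Rightarrow> 'a set) \<Rightarrow> (nat \<Rightarrow> 'a) \<Rightarrow> (nat \<Rightarrow> 'a) \<Rightarrow> bool" where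
  "links j S a b \<longleftrightarrow> (\<forall>i<j. a (Suc i) \<in> N (b i)) \<and>
     (\<forall>u\<in>\<Union>(S ` {0..j}). \<forall>v\<in>\<Union>(S ` {0..j}). v \<in> N u \<longrightarrow>
        (\<exists>i\<le>j. u \<in> S i \<and> v \<in> S i) \<or> (\<exists>i<j. {u, v} = {b i, a (Suc i)}))"

definition chain :: "nat \<Rightarrow> (nat \<Rightarrow> 'a set) \<Rightarrow> (nat \<Rightarrow> 'a) \<Rightarrow> (nat \<Rightarrow> 'a) \<Rightarrow> bool" where
  "chain j S a b \<longleftrightarrow> typeB (S 0) \<and> exit (S 0) (b 0) \<and>
     (\<forall>i\<in>{1..j}. seg (S i) \<and> exit (S i) (a i) \<and> exit (S i) (b i) \<and> a i \<noteq> b i) \<and>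
     (\<forall>i\<le>j. S i \<subseteq> V) \<and> disjoint_family_on S {0..j} \<and> links j S a b"

definition snake :: bool where
  "snake \<longleftrightarrow> (\<exists>j S a b. chain j S a b \<and> typeB (S (Suc j)) \<and> exit (S (Suc j)) (a (Suc j)) \<and>
     S (Suc j) \<inter> \<Union>(S ` {0..j}) = {} \<and> V = \<Union>(S ` {0..Suc j}) \<and> links (Suc j) S a b)"

lemma links_cong:
  assumes "links j S a b" "\<And>i. i \<le> j \<Longrightarrow> S' i = S i" "\<And>i. i \<le> j \<Longrightarrow> a' i = a i" "\<And>i. i < j \<Longrightarrow> b' i = b i"
  shows "links j S' a' b'"
proof -
  have "\<Union>(S' ` {0..j}) = \<Union>(S ` {0..j})" using assms(2) by auto
  moreover have "(\<exists>i<j. e = {b' i, a' (Suc i)}) \<longleftrightarrow> (\<exists>i<j. e = {b i, a (Suc i)})" for e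
    using assms by (metis Suc_leI)
  moreover have "(\<exists>i\<le>j. u \<in> S' i \<and> v \<in> S' i) \<longleftrightarrow> (\<exists>i\<le>j. u \<in> S i \<and> v \<in> S i)" for u v
    using assms by auto
  ultimately show ?thesis using assms unfolding links_def by (simp add: Suc_leI)
qed

lemma links_extend:
  assumes l: "links j S a b"
    and out: "N (b j) - \<Union>(S ` {0..j}) = {a (Suc j)}" "\<And>p. p \<in> \<Union>(S ` {0..j}) - {b j} \<Longrightarrow> N p \<subseteq> \<Union>(S ` {0..j})"
    and dis: "S (Suc j) \<inter> \<Union>(S ` {0..j}) = {}"
  shows "links (Suc j) S a b"
proof -
  let ?W = "\<Union>(S ` {0..j})"
  have W: "\<Union>(S ` {0..Suc j}) = ?W \<union> S (Suc j)" by (auto simp: atLeastAtMostSuc_conv)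
  have cross: "u = b j \<and> v = a (Suc j)" if "u \<in> ?W" "v \<notin> ?W" "v \<in> N u" for u v
    using out that by (cases "u = b j") blast+
  have a: "a (Suc i) \<in> N (b i)" if "i < Suc j" for i
    using l out that by (cases "i = j") (auto simp: links_def)
  have "(\<exists>i\<le>Suc j. u \<in> S i \<and> v \<in> S i) \<or> (\<exists>i<Suc j. {u, v} = {b i, a (Suc i)})"
    if uv: "u \<in> ?W \<union> S (Suc j)" "v \<in> ?W \<union> S (Suc j)" "v \<in> N u" for u v
  proof -
    consider "u \<in> ?W" "v \<in> ?W" | "u \<in> ?W" "v \<notin> ?W" | "u \<notin> ?W" "v \<in> ?W" | "u \<in> S (Suc j)" "v \<in> S (Suc j)"
      using uv by blast
    then show ?thesis
    proof cases
      case 1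
      then have "(\<exists>i\<le>j. u \<in> S i \<and> v \<in> S i) \<or> (\<exists>i<j. {u, v} = {b i, a (Suc i)})"
        using l uv(3) unfolding links_def by blast
      then show ?thesis by (meson le_SucI less_SucI)
    next
      case 2
      then show ?thesis using cross uv(3) by blast
    next
      case 3
      then show ?thesis using cross[of v u] uv(3) N_sym by blast
    next
      case 4
      then show ?thesis by blast
    qed
  qed
  then show ?thesis unfolding links_def W using a by blast
qed

text \<open>
  \<open>snake_tail \<B> B W x y\<close>: the set \<open>W\<close> is a B block \<open>B\<close> followed by segments of the family \<open>\<B>\<close>,
  and \<open>W\<close> can only be left along the edge from \<open>x\<close> to \<open>y\<close>.
\<close>

inductive snake_tail :: "'a set set \<Rightarrow> 'a set \<Rightarrow> 'a set \<Rightarrow> 'a \<Rightarrow> 'a \<Rightarrow> bool" for \<B> B where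
  start: "B \<in> \<B> \<Longrightarrow> typeB B \<Longrightarrow> u \<in> B \<Longrightarrow> N u - B = {y} \<Longrightarrow> snake_tail \<B> B B u y"
| step: "snake_tail \<B> B W x y \<Longrightarrow> S \<in> \<B> \<Longrightarrow> seg S \<Longrightarrow> y \<in> S \<Longrightarrow> y' \<in> S \<Longrightarrow> y' \<noteq> y \<Longrightarrow> N y' - S = {z}
    \<Longrightarrow> snake_tail \<B> B (W \<union> S) y' z"

text \<open>
  A block \<open>B\<close> of type A or B has too few pairs at distance \<open>2\<close> and claims \<open>d - 5\<close> of the pairs
  between \<open>x\<close> and \<open>M\<close>, where \<open>M\<close> is \<open>B\<close> itself or a maximal tail starting in \<open>B\<close>.
\<close>

definition demand :: "'a set set \<Rightarrow> 'a set \<Rightarrow> 'a set \<Rightarrow> 'a \<Rightarrow> bool" where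
  "demand \<B> B M x \<longleftrightarrow> (\<exists>\<S>\<subseteq>\<B>. B \<in> \<S> \<and> M = \<Union>\<S> \<and> (\<forall>S\<in>\<S> - {B}. seg S)) \<and>
     bd M = {x} \<and> d - 1 \<le> card (N2 x \<inter> M) \<and>
     (typeB B \<and> card (N x \<inter> M) = 1 \<or> typeA B \<and> M = B) \<and>
     (\<forall>H\<in>\<B>. x \<in> H \<longrightarrow> \<not> typeA H \<and> \<not> typeB H \<and> \<not> seg H)"

end

section \<open>Tails in a disjoint family of blocks\<close>

locale block_family = regular_graph +
  fixes \<B> :: "'a set set"
  assumes blocks: "H \<in> \<B> \<Longrightarrow> block H" and disjoint_blocks: "disjoint \<B>"
begin

lemma family_subset: "H \<in> \<B> \<Longrightarrow> H \<subseteq> V"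
  using blocks block_subset by blast

lemma blocks_eq: "H \<in> \<B> \<Longrightarrow> H' \<in> \<B> \<Longrightarrow> p \<in> H \<Longrightarrow> p \<in> H' \<Longrightarrow> H = H'"
  using disjoint_blocks by (metis disjointD disjoint_iff)

text \<open>Only the two ends of a segment have exits, so \<open>y'\<close> is the end opposite to
  \<open>y\<close>. The edge from \<open>y'\<close> cannot return to \<open>W\<close>, because
  \<open>W\<close> is left only along the edge from \<open>x\<close> to \<open>y\<close>.\<close>

lemma tail_step_facts:
  assumes "\<S> \<subseteq> \<B>" "W = \<Union>\<S>" "x \<in> W" "N x - W = {y}" "\<forall>p\<in>W - {x}. N p \<subseteq> W"
    and S: "S \<in> \<B>" "seg S" "y \<in> S" "y' \<in> S" "y' \<noteq> y" "N y' - S = {z}"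
  shows "S \<inter> W = {}" "N y - S = {x}" "z \<notin> W" "\<forall>p\<in>S - {y, y'}. N p \<subseteq> S"
proof -
  have yW: "y \<notin> W" "y \<in> N x" using assms(4) by auto
  show dis: "S \<inter> W = {}"
  proof (rule ccontr)
    assume "S \<inter> W \<noteq> {}"
    then obtain p T where p: "p \<in> S" "p \<in> T" "T \<in> \<S>" using assms(2) by blast
    then have "S = T" using blocks_eq assms(1) S by blast
    then show False using p S(3) yW assms(2) by blast
  qed
  have x: "x \<in> N y - S" using yW N_sym dis assms(3) by blast
  obtain c c' v v' where c: "c \<in> S" "c' \<in> S" "c \<noteq> c'" "N c - S = {v}" "N c' - S = {v'}"
    "\<forall>p\<in>S - {c, c'}. N p \<subseteq> S"
    using seg_ends[OF family_subset[OF S(1)] S(2)] by metis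
  have "y \<in> {c, c'}" "y' \<in> {c, c'}" using c(6) x S by blast+
  then have cc: "{c, c'} = {y, y'}" using S(5) by auto
  have "N y - S = {v} \<or> N y - S = {v'}" using \<open>y \<in> {c, c'}\<close> c(4,5) by blast
  then show "N y - S = {x}" using x by (metis singletonD)
  show "\<forall>p\<in>S - {y, y'}. N p \<subseteq> S" using c(6) cc by simp
  show "z \<notin> W"
  proof
    assume z: "z \<in> W"
    have "y' \<in> N z" using S(6) N_sym by blast
    moreover have "y' \<notin> W" using dis S(4) by blast
    ultimately have "z = x" using assms(5) z by blast
    then have "y' = y" using \<open>y' \<in> N z\<close> \<open>y' \<notin> W\<close> assms(4) by blast
    then show False using S(5) by simp
  qed
qed

lemma tail_props:
  assumes "snake_tail \<B> B W x y"
  shows "(\<exists>\<S>\<subseteq>\<B>. B \<in> \<S> \<and> W = \<Union>\<S> \<and> (\<forall>S\<in>\<S> - {B}. seg S)) \<and>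
    x \<in> W \<and> N x - W = {y} \<and> (\<forall>p\<in>W - {x}. N p \<subseteq> W) \<and> typeB B"
  using assms
proof (induction rule: snake_tail.induct)
  case (start u y)
  obtain u' where "\<forall>p\<in>B - {u'}. N p \<subseteq> B" using typeB_ends[OF start(2)] by metis
  moreover have "u = u'" using calculation start by blast
  moreover have "\<exists>\<S>\<subseteq>\<B>. B \<in> \<S> \<and> B = \<Union>\<S> \<and> (\<forall>S\<in>\<S> - {B}. seg S)"
    using start(1) by (intro exI[of _ "{B}"]) simp
  ultimately show ?case using start by simp
next
  case (step W x y S y' z)
  obtain \<S> where \<S>: "\<S> \<subseteq> \<B>" "B \<in> \<S>" "W = \<Union>\<S>" "\<forall>S\<in>\<S> - {B}. seg S" using step.IH by blast
  have W: "x \<in> W" "N x - W = {y}" "\<forall>p\<in>W - {x}. N p \<subseteq> W" using step.IH by auto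
  note f = tail_step_facts[OF \<S>(1,3) W step.hyps(2-7)]
  have "\<exists>\<S>\<subseteq>\<B>. B \<in> \<S> \<and> W \<union> S = \<Union>\<S> \<and> (\<forall>S\<in>\<S> - {B}. seg S)"
    using \<S> step.hyps(2,3) by (intro exI[of _ "insert S \<S>"]) auto
  moreover have "N y' - (W \<union> S) = {z}" using step.hyps(7) f(3) by blast
  moreover have "\<forall>p\<in>(W \<union> S) - {y'}. N p \<subseteq> W \<union> S"
  proof
    fix p assume p: "p \<in> (W \<union> S) - {y'}"
    have "N x \<subseteq> insert y W" "N y \<subseteq> insert x S" using W(2) f(2) by blast+
    then show "N p \<subseteq> W \<union> S"
      using p W(1,3) f(4) step.hyps(4) by (cases "p = x"; cases "p = y") blast+
  qed
  moreover have "y' \<in> W \<union> S" "typeB B" using step.hyps(5) step.IH by simp_all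
  ultimately show ?case by (intro conjI)
qed

text \<open>Inductive tails suit the maximality argument; \<open>snake_graph\<close> asks for an
  indexed sequence. The induction translates one into the other.\<close>

lemma tail_chain:
  assumes "snake_tail \<B> B W x y"
  shows "\<exists>j S a b. chain j S a b \<and> W = \<Union>(S ` {0..j}) \<and> b j = x"
  using assms
proof (induction rule: snake_tail.induct)
  case (start u y)
  then have "chain 0 (\<lambda>_. B) (\<lambda>_. u) (\<lambda>_. u)"
    using family_subset by (auto simp: chain_def exit_def links_def disjoint_family_on_def)
  moreover have "B = \<Union>((\<lambda>_. B) ` {0..0::nat})" by simp
  ultimately show ?case by (intro exI conjI) (assumption | rule refl)+
next
  case (step W x y T y' z)
  obtain j S a b where ch: "chain j S a b" and WS: "W = \<Union>(S ` {0..j})" and bj: "b j = x"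
    using step.IH by blast
  note tp = tail_props[OF step.hyps(1)]
  obtain \<S> where \<S>: "\<S> \<subseteq> \<B>" "W = \<Union>\<S>" using tp by blast
  have W: "x \<in> W" "N x - W = {y}" "\<forall>p\<in>W - {x}. N p \<subseteq> W" using tp by auto
  note f = tail_step_facts[OF \<S> W step.hyps(2-7)]
  define S' where "S' = S(Suc j := T)"
  define a' where "a' = a(Suc j := y)"
  define b' where "b' = b(Suc j := y')"
  have eq: "S' i = S i" "a' i = a i" "b' i = b i" if "i \<le> j" for i
    using that by (auto simp: S'_def a'_def b'_def)
  have new: "S' (Suc j) = T" "a' (Suc j) = y" "b' (Suc j) = y'" by (auto simp: S'_def a'_def b'_def)
  have WS': "\<Union>(S' ` {0..j}) = W" unfolding WS using eq by auto
  have "links j S' a' b'"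
  proof (rule links_cong)
    show "links j S a b" using ch by (simp add: chain_def)
  qed (simp_all add: eq)
  then have "links (Suc j) S' a' b'"
  proof (rule links_extend)
    have bj': "b' j = x" using eq[of j] bj by simp
    show "N (b' j) - \<Union>(S' ` {0..j}) = {a' (Suc j)}" unfolding WS' bj' new by (rule W(2))
    show "N p \<subseteq> \<Union>(S' ` {0..j})" if "p \<in> \<Union>(S' ` {0..j}) - {b' j}" for p
      using that W(3) unfolding WS' bj' by blast
    show "S' (Suc j) \<inter> \<Union>(S' ` {0..j}) = {}" unfolding WS' new by (rule f(1))
  qed
  moreover have "disjoint_family_on S' {0..Suc j}"
  proof -
    have "disjoint_family_on S' {0..j}" using ch eq by (auto simp: chain_def disjoint_family_on_def)
    moreover have "S' (Suc j) \<inter> \<Union>(S' ` {0..j}) = {}" using WS' new f(1) by simp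
    moreover have "{0..Suc j} = insert (Suc j) {0..j}" by auto
    ultimately show ?thesis by (simp add: disjoint_family_on_insert)
  qed
  moreover have "seg (S' i) \<and> exit (S' i) (a' i) \<and> exit (S' i) (b' i) \<and> a' i \<noteq> b' i" if "i \<in> {1..Suc j}" for i
  proof (cases "i = Suc j")
    case True
    have "exit T y" "exit T y'" using f step.hyps by (auto simp: exit_def)
    then show ?thesis using True new step.hyps by auto
  next
    case False
    then show ?thesis using that ch eq by (auto simp: chain_def)
  qed
  moreover have "S' i \<subseteq> V" if "i \<le> Suc j" for i
    using that ch eq new family_subset[OF step.hyps(2)] by (cases "i = Suc j") (auto simp: chain_def)
  moreover have "typeB (S' 0)" "exit (S' 0) (b' 0)" using ch eq by (auto simp: chain_def)
  ultimately have "chain (Suc j) S' a' b'" by (simp add: chain_def)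
  moreover have "W \<union> T = \<Union>(S' ` {0..Suc j})" using WS' new by (auto simp: atLeastAtMostSuc_conv)
  ultimately show ?case using new by blast
qed

text \<open>The edge between \<open>x\<close> and \<open>y\<close> is the only exit of
  \<open>W\<close> and of \<open>H\<close>. Nothing leaves \<open>W \<union> H\<close>, and
  connectivity makes it the whole graph.\<close>

lemma tail_snake:
  assumes t: "snake_tail \<B> B W x y" and H: "H \<in> \<B>" "typeB H" "y \<in> H"
  shows snake
proof -
  note tp = tail_props[OF t]
  obtain \<S> where \<S>: "\<S> \<subseteq> \<B>" "W = \<Union>\<S>" using tp by blast
  have W: "x \<in> W" "N x - W = {y}" "\<forall>p\<in>W - {x}. N p \<subseteq> W" using tp by auto
  obtain j S a b where ch: "chain j S a b" and WS: "W = \<Union>(S ` {0..j})" and bj: "b j = x"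
    using tail_chain[OF t] by blast
  have dis: "H \<inter> W = {}"
  proof (rule ccontr)
    assume "H \<inter> W \<noteq> {}"
    then obtain p T where p: "p \<in> H" "p \<in> T" "T \<in> \<S>" using \<S>(2) by blast
    then have "H = T" using blocks_eq \<S>(1) H by blast
    then show False using p H(3) W \<S>(2) by blast
  qed
  obtain u v where u: "bd H = {v}" using typeB_ends[OF H(2)] by metis
  have "x \<in> bd H" using W H(3) dis by (intro bd_I[of y]) (auto intro: N_sym)
  then have bdH: "bd H = {x}" using u by auto
  have WV: "W \<subseteq> V" using \<S> family_subset by blast
  have V: "V = W \<union> H"
  proof (rule ccontr)
    assume "V \<noteq> W \<union> H"
    moreover have "W \<union> H \<subseteq> V" "W \<union> H \<noteq> {}" using WV family_subset[OF H(1)] W(1) by auto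
    ultimately obtain p q where pq: "p \<in> W \<union> H" "q \<in> V - (W \<union> H)" "q \<in> N p" using cut[of "W \<union> H"] by metis
    show False
    proof (cases "p \<in> W")
      case True
      moreover have "N x \<subseteq> insert y W" using W(2) by blast
      ultimately have "q \<in> insert y W" using pq(3) W(3) by (cases "p = x") blast+
      then show False using pq(2) H(3) by blast
    next
      case False
      then have "q \<in> bd H" using pq bd_I by blast
      then have "q = x" using bdH by simp
      then show False using W(1) pq(2) by simp
    qed
  qed
  define S' where "S' = S(Suc j := H)"
  define a' where "a' = a(Suc j := y)"
  have eq: "S' i = S i" "a' i = a i" if "i \<le> j" for i
    using that by (auto simp: S'_def a'_def)
  have new: "S' (Suc j) = H" "a' (Suc j) = y" by (auto simp: S'_def a'_def)
  have WS': "\<Union>(S' ` {0..j}) = W" unfolding WS using eq by auto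
  have l: "links j S' a' b"
  proof (rule links_cong)
    show "links j S a b" using ch by (simp add: chain_def)
  qed (simp_all add: eq)
  then have "links (Suc j) S' a' b"
  proof (rule links_extend)
    show "N (b j) - \<Union>(S' ` {0..j}) = {a' (Suc j)}" unfolding WS' bj new by (rule W(2))
    show "N p \<subseteq> \<Union>(S' ` {0..j})" if "p \<in> \<Union>(S' ` {0..j}) - {b j}" for p
      using that W(3) unfolding WS' bj by blast
    show "S' (Suc j) \<inter> \<Union>(S' ` {0..j}) = {}" unfolding WS' new by (rule dis)
  qed
  moreover have "chain j S' a' b"
    using ch l eq by (auto simp: chain_def disjoint_family_on_def)
  moreover have "x \<in> N y" "x \<notin> H" using W N_sym dis by blast+
  then have "exit H y" using H(3) by (auto simp: exit_def)
  moreover have "V = \<Union>(S' ` {0..Suc j})" using V WS' new by (auto simp: atLeastAtMostSuc_conv)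
  ultimately show ?thesis unfolding snake_def using H(2) new WS' dis by metis
qed

text \<open>A segment containing \<open>y\<close> could be appended through its other end, and the
  tail would grow since \<open>y\<close> lies outside \<open>W\<close>.\<close>

lemma maximal_tail:
  assumes "B \<in> \<B>" "typeB B"
  shows "\<exists>W x y. snake_tail \<B> B W x y \<and> \<not> (\<exists>S\<in>\<B>. seg S \<and> y \<in> S)"
proof -
  obtain u z where "u \<in> B" "N u - B = {z}" using typeB_ends[OF assms(2)] by metis
  then have "snake_tail \<B> B B u z" using assms start by blast
  then have "\<exists>W. (\<exists>x y. snake_tail \<B> B W x y)" by blast
  moreover have WV: "W \<subseteq> V" if t: "snake_tail \<B> B W x y" for W x y
    using tail_props[OF t] family_subset by blast
  ultimately obtain W x y where t: "snake_tail \<B> B W x y" and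
    max: "\<And>W' x' y'. snake_tail \<B> B W' x' y' \<Longrightarrow> card W' \<le> card W"
    using ex_has_greatest_nat[of "\<lambda>W. \<exists>x y. snake_tail \<B> B W x y" _ card "Suc (card V)"]
      card_mono[OF finite_V] by (metis le_imp_less_Suc)
  have "\<not> (\<exists>S\<in>\<B>. seg S \<and> y \<in> S)"
  proof
    assume "\<exists>S\<in>\<B>. seg S \<and> y \<in> S"
    then obtain S where S: "S \<in> \<B>" "seg S" "y \<in> S" by blast
    note tp = tail_props[OF t]
    obtain c c' v v' where c: "c \<in> S" "c' \<in> S" "c \<noteq> c'" "N c - S = {v}" "N c' - S = {v'}"
      using seg_ends[OF family_subset[OF S(1)] S(2)] by metis
    obtain y' z' where y': "y' \<in> S" "y' \<noteq> y" "N y' - S = {z'}"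
      using c by (cases "y = c") blast+
    have "snake_tail \<B> B (W \<union> S) y' z'" using step[OF t S y'] .
    then have "card (W \<union> S) \<le> card W" by (rule max)
    moreover have "y \<notin> W" using tp by auto
    then have "W \<subset> W \<union> S" using S(3) by blast
    moreover have "finite (W \<union> S)" using WV[OF t] family_subset[OF S(1)] finite_V finite_subset by blast
    ultimately show False using psubset_card_mono by (metis not_le)
  qed
  then show ?thesis using t by blast
qed

section \<open>Existence of demands\<close>

lemma demand_typeA:
  assumes B: "B \<in> \<B>" "typeA B"
  shows "\<exists>M x. demand \<B> B M x"
proof -
  obtain w w' z where w: "w \<in> B" "w' \<in> B" "w \<noteq> w'" "w' \<notin> N w" "bd B = {z}" "N w - B = {z}" "N w' - B = {z}"
    "N z \<inter> B = {w, w'}" "\<forall>p\<in>B - {w, w'}. N p \<subseteq> B"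
    by (rule typeA_ends[OF family_subset[OF B(1)] B(2)])
  have cB: "card B = d + 1" using B(2) by (simp add: typeA_def)
  have zB: "z \<notin> B" using w(5) by (auto simp: bd_def)
  have finB: "finite B" using family_subset[OF B(1)] finite_subset_V by blast
  \<comment> \<open>A vertex without exits misses nothing in a block of size \<open>d + 1\<close>,
    so it reaches \<open>z\<close> through \<open>w\<close>.\<close>
  have "B - {w, w'} \<subseteq> N2 z \<inter> B"
  proof
    fix p assume p: "p \<in> B - {w, w'}"
    have "card (N p - B) = 0" using p w(9) by (simp add: Diff_eq_empty_iff)
    then have "card (B - N p - {p}) = 0" using card_missed[OF family_subset[OF B(1)], of p] p cB by auto
    then have "w \<in> N p" using finB w p by auto
    moreover have "w \<in> N z" using w by auto
    ultimately show "p \<in> N2 z \<inter> B" using p zB w(8) family_subset[OF B(1)] by (auto simp: N2_def)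
  qed
  then have "card (B - {w, w'}) \<le> card (N2 z \<inter> B)" by (intro card_mono) auto
  moreover have "card (B - {w, w'}) = card B - card {w, w'}" using w by (intro card_Diff_subset) auto
  ultimately have "d - 1 \<le> card (N2 z \<inter> B)" using w(3) cB by simp
  \<comment> \<open>Both \<open>w\<close> and \<open>w'\<close> are boundary vertices of
    \<open>H\<close> attached to the same vertex \<open>z\<close>. Types A and B have only one
    boundary vertex, and the two boundary vertices of a segment attach to different ends.\<close>
  moreover have "\<not> typeA H \<and> \<not> typeB H \<and> \<not> seg H" if H: "H \<in> \<B>" "z \<in> H" for H
  proof -
    have HB: "H \<inter> B = {}" using H B blocks_eq zB by blast
    have wz: "w \<in> N z" "w' \<in> N z" using w(8) by blast+
    then have bdH: "w \<in> bd H" "w' \<in> bd H" using H HB w(1,2) bd_I[of z H] by blast+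
    then have "card (bd H) \<noteq> 1" using w(3) by (auto simp: card_1_singleton_iff)
    moreover have "\<not> seg H"
    proof
      assume "seg H"
      then obtain c c' v v' where "c \<noteq> c'" "bd H = {v, v'}" "N v \<inter> H = {c}" "N v' \<inter> H = {c'}" "v \<noteq> v'"
        using seg_ends[OF family_subset[OF H(1)]] by metis
      moreover have "z \<in> N w \<inter> H" "z \<in> N w' \<inter> H" using wz N_sym H(2) by blast+
      ultimately show False using bdH w(3) by auto
    qed
    ultimately show ?thesis by (simp add: typeA_def typeB_def)
  qed
  moreover have "\<exists>\<S>\<subseteq>\<B>. B \<in> \<S> \<and> B = \<Union>\<S> \<and> (\<forall>S\<in>\<S> - {B}. seg S)"
    using B(1) by (intro exI[of _ "{B}"]) simp
  ultimately have "demand \<B> B B z" unfolding demand_def using w(5) B(2) by simp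
  then show ?thesis by blast
qed

text \<open>The claimed pairs join \<open>y\<close> to the \<open>d - 1\<close> neighbours of
  \<open>x\<close> in \<open>W\<close>. If \<open>y\<close> lay in a special block, a segment would
  contradict maximality, a type B block would complete a snake, and type A would need two edges from
  \<open>x\<close>, which has only the one to \<open>y\<close>.\<close>

lemma demand_typeB:
  assumes B: "B \<in> \<B>" "typeB B" and "\<not> snake"
  shows "\<exists>M x. demand \<B> B M x"
proof -
  obtain W x y where t: "snake_tail \<B> B W x y" and noseg: "\<not> (\<exists>S\<in>\<B>. seg S \<and> y \<in> S)"
    using maximal_tail[OF B] by blast
  note tp = tail_props[OF t]
  obtain \<S> where \<S>: "\<S> \<subseteq> \<B>" "W = \<Union>\<S>" using tp by blast
  have W: "x \<in> W" "N x - W = {y}" "\<forall>p\<in>W - {x}. N p \<subseteq> W" using tp by auto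
  have WV: "W \<subseteq> V" using \<S> family_subset by blast
  have yx: "y \<in> N x" "x \<in> N y" "y \<notin> W" using W(2) N_sym by blast+
  have bdW: "bd W = {y}"
  proof
    show "bd W \<subseteq> {y}"
    proof
      fix z assume "z \<in> bd W"
      then obtain c where c: "z \<notin> W" "c \<in> W" "z \<in> N c" using N_sym by (auto simp: bd_def)
      then show "z \<in> {y}" using W by (cases "c = x") blast+
    qed
    show "{y} \<subseteq> bd W" using bd_I W(1) yx by blast
  qed
  have Ny: "N y \<inter> W = {x}"
  proof -
    have "p = x" if "p \<in> N y \<inter> W" for p
    proof (rule ccontr)
      assume "p \<noteq> x"
      then have "N p \<subseteq> W" using W(3) that by blast
      moreover have "y \<in> N p" using that N_sym by blast
      ultimately show False using yx(3) by blast
    qed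
    then show ?thesis using W(1) yx by blast
  qed
  have "N x \<inter> W \<subseteq> N2 y \<inter> W"
  proof
    fix p assume p: "p \<in> N x \<inter> W"
    then have "p \<noteq> x" using N_irrefl by blast
    then have "p \<notin> N y" using Ny p by blast
    moreover have "x \<in> N y \<inter> N p" using yx p N_sym by blast
    ultimately show "p \<in> N2 y \<inter> W" using p yx(3) WV by (auto simp: N2_def)
  qed
  then have "card (N x \<inter> W) \<le> card (N2 y \<inter> W)" by (intro card_mono) auto
  moreover have "card (N x \<inter> W) + 1 = d" using card_N_split[of x W] W WV by auto
  ultimately have "d - 1 \<le> card (N2 y \<inter> W)" by simp
  moreover have "\<not> typeA H \<and> \<not> typeB H \<and> \<not> seg H" if H: "H \<in> \<B>" "y \<in> H" for H
  proof -
    have HW: "H \<inter> W = {}"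
    proof (rule ccontr)
      assume "H \<inter> W \<noteq> {}"
      then obtain p T where p: "p \<in> H" "p \<in> T" "T \<in> \<S>" using \<S>(2) by blast
      then have "H = T" using blocks_eq \<S>(1) H by blast
      then show False using p H(2) yx(3) \<S>(2) by blast
    qed
    have "x \<in> bd H" using bd_I[OF H(2) yx(2)] HW W(1) by blast
    moreover have "N x \<inter> H \<subseteq> {y}" using W(2) HW by blast
    then have "card (N x \<inter> H) \<le> card {y}" by (intro card_mono) auto
    moreover have "card (N x \<inter> H) = 2" if "typeA H" using that \<open>x \<in> bd H\<close> by (simp add: typeA_def)
    ultimately have "\<not> typeA H" by fastforce
    moreover have "\<not> typeB H" using tail_snake[OF t H(1) _ H(2)] assms(3) by blast
    ultimately show ?thesis using noseg H by blast
  qed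
  moreover have "card (N y \<inter> W) = 1" using Ny by simp
  ultimately have "demand \<B> B W y" unfolding demand_def using bdW tp by simp
  then show ?thesis by blast
qed

end

subsection \<open>Discharging\<close>

text \<open>For a given sum the product is least when one factor sits at its lower bound
  \<open>m\<close>.\<close>

lemma mult_lower_bound:
  fixes a b m :: int
  assumes "m \<le> a" "m \<le> b" "n \<le> a + b" "0 \<le> m"
  shows "m * (n - m) \<le> a * b"
proof -
  have "0 \<le> (a - m) * (b - m)" using assms by simp
  moreover have "m * n \<le> m * (a + b)" using assms by (intro mult_left_mono) auto
  ultimately show ?thesis by (simp add: algebra_simps)
qed

text \<open>Sizes and exits replace the list of missing pairs inside \<open>R2\<close>, which
  counting recovers in \<open>peanut_graph_if_peanut\<close>.\<close>

definition (in regular_graph) peanut_parts :: "'a set \<Rightarrow> 'a set \<Rightarrow> 'a \<Rightarrow> 'a \<Rightarrow> 'a \<Rightarrow> bool" where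
  "peanut_parts R1 R2 w1 w2 u \<longleftrightarrow> V = R1 \<union> R2 \<and> R1 \<inter> R2 = {} \<and> card R1 = d + 1 \<and> card R2 = d + 2 \<and>
     w1 \<noteq> w2 \<and> w1 \<in> R1 \<and> w2 \<in> R1 \<and> w2 \<notin> N w1 \<and> u \<in> R2 \<and>
     N u - R2 = {w1, w2} \<and> N w1 - R1 = {u} \<and> N w2 - R1 = {u} \<and>
     (\<forall>p\<in>R1 - {w1, w2}. N p \<subseteq> R1) \<and> (\<forall>p\<in>R2 - {u}. N p \<subseteq> R2)"

definition (in regular_graph) peanut :: bool where
  "peanut \<longleftrightarrow> even d \<and> (\<exists>R1 R2 w1 w2 u. peanut_parts R1 R2 w1 w2 u)"

section \<open>Demands claimed at a common vertex\<close>

locale demand_family = block_family +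
  fixes M :: "'a set \<Rightarrow> 'a set" and pt :: "'a set \<Rightarrow> 'a"
  assumes demands: "B \<in> \<B> \<Longrightarrow> typeA B \<or> typeB B \<Longrightarrow> demand \<B> B (M B) (pt B)"
begin

definition D :: "'a set set" where
  "D = {B \<in> \<B>. typeA B \<or> typeB B}"

definition claims :: "'a \<Rightarrow> 'a set set" where
  "claims p = {B \<in> D. pt B = p}"

lemma demand_D: "B \<in> D \<Longrightarrow> demand \<B> B (M B) (pt B)"
  using demands by (simp add: D_def)

lemma finite_\<B>: "finite \<B>"
proof (rule finite_subset)
  show "\<B> \<subseteq> Pow V" using family_subset by blast
qed (simp add: finite_V)

lemma finite_D: "finite D"
  using finite_\<B> by (simp add: D_def)

lemma finite_claims: "finite (claims p)"
  using finite_D by (simp add: claims_def)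

lemma M_parts:
  assumes "B \<in> D"
  obtains \<S> where "\<S> \<subseteq> \<B>" "B \<in> \<S>" "M B = \<Union>\<S>" "\<forall>S\<in>\<S> - {B}. seg S"
proof -
  have "\<exists>\<S>\<subseteq>\<B>. B \<in> \<S> \<and> M B = \<Union>\<S> \<and> (\<forall>S\<in>\<S> - {B}. seg S)"
    using demand_D[OF assms] by (simp add: demand_def)
  then show ?thesis using that by meson
qed

lemma bd_M: "B \<in> D \<Longrightarrow> bd (M B) = {pt B}"
  using demand_D by (simp add: demand_def)

lemma pt_V: "B \<in> D \<Longrightarrow> pt B \<in> V"
  using bd_M[of B] by (auto simp: bd_def)

lemma pt_notin: "B \<in> D \<Longrightarrow> pt B \<notin> M B"
  using bd_M[of B] by (auto simp: bd_def)

lemma leave_M: "B \<in> D \<Longrightarrow> c \<in> M B \<Longrightarrow> q \<in> N c \<Longrightarrow> q \<notin> M B \<Longrightarrow> q = pt B"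
  using bd_I[of c "M B" q] bd_M[of B] by simp

lemma M_subset:
  assumes "B \<in> D"
  shows "M B \<subseteq> V"
proof -
  obtain \<S> where "\<S> \<subseteq> \<B>" "M B = \<Union>\<S>" using M_parts[OF assms] .
  then show ?thesis using family_subset by blast
qed

lemma M_block:
  assumes "B \<in> D" "H \<in> \<B>" "p \<in> H" "p \<in> M B"
  shows "H \<subseteq> M B" "H = B \<or> seg H"
proof -
  obtain \<S> where S: "\<S> \<subseteq> \<B>" "B \<in> \<S>" "M B = \<Union>\<S>" "\<forall>S\<in>\<S> - {B}. seg S" using M_parts[OF assms(1)] .
  obtain T where "T \<in> \<S>" "p \<in> T" using S assms(4) by blast
  then have "H \<in> \<S>" using blocks_eq[of H T p] S(1) assms by blast
  then show "H \<subseteq> M B" "H = B \<or> seg H" using S by blast+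
qed

lemma not_seg: "B \<in> D \<Longrightarrow> \<not> seg B"
  by (auto simp: D_def typeA_def typeB_def seg_def)

lemma D_nonempty: "B \<in> D \<Longrightarrow> B \<noteq> {} \<and> B \<subseteq> M B"
proof -
  assume "B \<in> D"
  then have "card B \<noteq> 0" by (auto simp: D_def typeA_def typeB_def)
  then show ?thesis using M_parts[OF \<open>B \<in> D\<close>] by (metis Union_upper card.empty)
qed

text \<open>By connectivity, every part of \<open>M B\<close> closed under adjacency within
  \<open>M B\<close> must touch \<open>pt B\<close>. No edge of \<open>M B\<close> joins
  \<open>M B \<inter> M B'\<close> to \<open>M B - M B'\<close>, since leaving \<open>M B'\<close>
  means reaching \<open>pt B'\<close>. Two nonempty pieces would need two contacts.\<close>

lemma M_single_contact_subset:
  assumes "B \<in> D" "B' \<in> D" "pt B = pt B'" "card (N (pt B) \<inter> M B) = 1" "M B \<inter> M B' \<noteq> {}"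
  shows "M B \<subseteq> M B'"
proof (rule ccontr)
  assume "\<not> M B \<subseteq> M B'"
  let ?x = "pt B"
  have contact: "\<exists>c\<in>A. c \<in> N ?x"
    if A: "A \<noteq> {}" "A \<subseteq> M B" "\<And>c q. c \<in> A \<Longrightarrow> q \<in> N c \<Longrightarrow> q \<in> M B \<Longrightarrow> q \<in> A" for A
  proof -
    have "A \<subseteq> V" using A M_subset assms(1) by blast
    moreover have "A \<noteq> V" using A(2) pt_notin[OF assms(1)] pt_V[OF assms(1)] by blast
    ultimately obtain c q where c: "c \<in> A" "q \<in> V - A" "q \<in> N c" using cut[of A] A(1) by metis
    then have "q = ?x" using leave_M[OF assms(1), of c q] A by blast
    then show ?thesis using c N_sym by blast
  qed
  have same: "q \<in> M B'" if "c \<in> M B'" "c \<in> M B" "q \<in> N c" "q \<in> M B" for c q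
    using leave_M[OF assms(2) that(1,3)] pt_notin[OF assms(1)] assms(3) that by metis
  have "\<exists>c\<in>M B - M B'. c \<in> N ?x"
    by (rule contact) (use \<open>\<not> M B \<subseteq> M B'\<close> same N_sym in blast)+
  moreover have "\<exists>c\<in>M B \<inter> M B'. c \<in> N ?x"
    by (rule contact) (use assms(5) same in blast)+
  ultimately obtain c c' where "c \<in> N ?x \<inter> M B" "c' \<in> N ?x \<inter> M B" "c \<noteq> c'" by blast
  then show False using assms(4) by (metis card_1_singletonE singletonD)
qed

text \<open>A family member inside \<open>M B'\<close> is \<open>B'\<close> or a segment, so
  \<open>B\<close> cannot meet \<open>M B'\<close>, and vice versa. Overlapping parts are thus both
  proper tails with one contact, and then one contains the other together with its B block.\<close>

lemma M_disjoint:
  assumes "B \<in> D" "B' \<in> D" "pt B = pt B'" "B \<noteq> B'"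
  shows "M B \<inter> M B' = {}"
proof (rule ccontr)
  assume ne: "M B \<inter> M B' \<noteq> {}"
  have cross: "False" if C: "C \<in> D" "C' \<in> D" "C \<noteq> C'" "C \<inter> M C' \<noteq> {}" for C C'
    using M_block(2)[OF C(2), of C] C not_seg by (auto simp: D_def)
  have "M B \<noteq> B" using cross[of B B'] assms ne by auto
  moreover have "M B' \<noteq> B'" using cross[of B' B] assms ne by auto
  ultimately have "card (N (pt B) \<inter> M B) = 1" "card (N (pt B') \<inter> M B') = 1"
    using demand_D assms(1,2) unfolding demand_def by blast+
  then have "M B \<subseteq> M B'" using M_single_contact_subset[of B B'] assms ne by blast
  then have "B \<inter> M B' \<noteq> {}" using D_nonempty[OF assms(1)] by blast
  then show False using cross[of B B'] assms by blast
qed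

lemma card_claims_le: "(d - 1) * card (claims p) \<le> card (N2 p \<inter> \<Union>(M ` claims p))"
proof -
  have "(d - 1) * card (claims p) = (\<Sum>B\<in>claims p. d - 1)" by simp
  also have "\<dots> \<le> (\<Sum>B\<in>claims p. card (N2 p \<inter> M B))"
    by (intro sum_mono) (use demand_D in \<open>auto simp: demand_def claims_def\<close>)
  also have "\<dots> = card (\<Union>B\<in>claims p. N2 p \<inter> M B)"
    by (rule card_UN_disjoint[symmetric]) (use finite_claims M_disjoint in \<open>auto simp: claims_def\<close>)
  also have "(\<Union>B\<in>claims p. N2 p \<inter> M B) = N2 p \<inter> \<Union>(M ` claims p)" by auto
  finally show ?thesis .
qed

lemma claimed_avoids_block:
  assumes "H \<in> \<B>" "p \<in> H" "B \<in> claims p"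
  shows "M B \<inter> H = {}"
proof (rule ccontr)
  assume "M B \<inter> H \<noteq> {}"
  moreover have B: "B \<in> D" "pt B = p" using assms(3) by (simp_all add: claims_def)
  ultimately have "H \<subseteq> M B" using M_block(1) assms(1) by blast
  then show False using pt_notin B assms(2) by blast
qed

text \<open>A boundary vertex of \<open>H\<close> inside \<open>M B\<close> has a neighbour in
  \<open>H\<close>, hence outside \<open>M B\<close>; that neighbour is \<open>p\<close>, so the
  vertex is not at distance \<open>2\<close> from \<open>p\<close>.\<close>

lemma demand_outer:
  assumes "H \<in> \<B>" "p \<in> H"
  shows "N2 p \<inter> \<Union>(M ` claims p) \<subseteq> N2 p - H - bd H"
proof
  fix r assume "r \<in> N2 p \<inter> \<Union>(M ` claims p)"
  then obtain B where r: "r \<in> N2 p" "B \<in> claims p" "r \<in> M B" by blast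
  have MH: "M B \<inter> H = {}" using claimed_avoids_block assms r by blast
  have "r \<notin> bd H"
  proof
    assume "r \<in> bd H"
    then obtain c where c: "c \<in> H" "c \<in> N r" by (auto simp: bd_def)
    then have "c = p" using leave_M[of B r c] r MH by (auto simp: claims_def)
    then show False using c N_sym r by (auto simp: N2_def)
  qed
  then show "r \<in> N2 p - H - bd H" using r MH by blast
qed

lemma outer_ge:
  assumes "H \<in> \<B>" "p \<in> H"
  shows "(d - 1) * card (claims p) \<le> card (N2 p - H - bd H)"
proof -
  have "card (N2 p \<inter> \<Union>(M ` claims p)) \<le> card (N2 p - H - bd H)"
    by (intro card_mono demand_outer assms) auto
  then show ?thesis using card_claims_le[of p] by linarith
qed

text \<open>The far neighbours of \<open>z\<close> come on top of the claimed vertices: a neighbour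
  of \<open>z\<close> inside some \<open>M B\<close> would make \<open>z\<close> the exit point
  \<open>p\<close>, but \<open>z\<close> lies outside \<open>H\<close>.\<close>

lemma outer_ge_contact:
  assumes H: "H \<in> \<B>" "p \<in> H" and z: "z \<in> bd H" "p \<in> N z" "z \<notin> \<Union>(M ` claims p)"
  shows "(d - 1) * card (claims p) + card (N z - H - bd H) \<le> card (N2 p - H - bd H)"
proof -
  have zH: "z \<notin> H" using z by (auto simp: bd_def)
  have "N z - H - bd H \<subseteq> N2 p - H - bd H"
  proof
    fix r assume r: "r \<in> N z - H - bd H"
    then have "r \<notin> N p" "r \<noteq> p" using bd_I[of p H r] H by blast+
    moreover have "z \<in> N p \<inter> N r" using z r N_sym by blast
    ultimately show "r \<in> N2 p - H - bd H" using r N_in_V by (auto simp: N2_def)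
  qed
  moreover have "r \<notin> \<Union>(M ` claims p)" if r: "r \<in> N z" for r
  proof
    assume "r \<in> \<Union>(M ` claims p)"
    then obtain B where B: "B \<in> claims p" "r \<in> M B" by blast
    then have "z = p" using leave_M[of B r z] N_sym[OF r] z(3) by (auto simp: claims_def)
    then show False using zH H by simp
  qed
  ultimately have "(N2 p \<inter> \<Union>(M ` claims p)) \<union> (N z - H - bd H) \<subseteq> N2 p - H - bd H"
    and dis: "(N2 p \<inter> \<Union>(M ` claims p)) \<inter> (N z - H - bd H) = {}"
    using demand_outer[OF H] by blast+
  then have "card ((N2 p \<inter> \<Union>(M ` claims p)) \<union> (N z - H - bd H)) \<le> card (N2 p - H - bd H)"
    by (intro card_mono) auto
  moreover have "card ((N2 p \<inter> \<Union>(M ` claims p)) \<union> (N z - H - bd H)) =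
      card (N2 p \<inter> \<Union>(M ` claims p)) + card (N z - H - bd H)"
    by (rule card_Un_disjoint[OF _ _ dis]) auto
  ultimately show ?thesis using card_claims_le[of p] by linarith
qed

text \<open>
  \<open>gain p\<close> is what \<open>p\<close> keeps after paying the demands at \<open>p\<close>. By \<open>outer_ge\<close> the vertices that \<open>p\<close> pays
  with lie outside the block of \<open>p\<close> and its boundary, so \<open>outer H p\<close> stays nonnegative.
\<close>

definition gain :: "'a \<Rightarrow> int" where
  "gain p = int (card (N2 p)) - (int d - 5) * int (card (claims p))"

definition outer :: "'a set \<Rightarrow> 'a \<Rightarrow> int" where
  "outer H p = int (card (N2 p - H - bd H)) - (int d - 5) * int (card (claims p))"

text \<open>At such a boundary vertex the far neighbours may coincide with pairs already spent on a
  demand, so it yields no surplus.\<close>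

definition demanding :: "'a set \<Rightarrow> 'a \<Rightarrow> bool" where
  "demanding H z \<longleftrightarrow> (\<exists>p\<in>H. \<exists>B\<in>claims p. z \<in> M B)"

lemma demanding_single:
  assumes H: "H \<in> \<B>" "p \<in> H" and z: "z \<in> bd H" "B \<in> claims p" "z \<in> M B"
  shows "N z \<inter> H = {p}"
proof -
  have "c = p" if "c \<in> N z \<inter> H" for c
    using leave_M[of B z c] that z claimed_avoids_block[OF H z(2)] by (auto simp: claims_def)
  moreover have "N z \<inter> H \<noteq> {}" using z by (auto simp: bd_def)
  ultimately show ?thesis by blast
qed

lemma demanding_card:
  assumes "H \<in> \<B>" "z \<in> bd H" "demanding H z"
  shows "card (N z \<inter> H) = 1"
  using assms demanding_single unfolding demanding_def by (metis is_singletonI is_singleton_altdef)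

section \<open>Gain of a single block\<close>

context
  assumes d9: "9 \<le> d"
begin

lemma outer_nonneg:
  assumes "H \<in> \<B>" "p \<in> H"
  shows "0 \<le> outer H p"
proof -
  have "int (d - 1) * int (card (claims p)) \<le> int (card (N2 p - H - bd H))"
    using outer_ge[OF assms] by (metis of_nat_le_iff of_nat_mult)
  moreover have "(int d - 5) * int (card (claims p)) \<le> int (d - 1) * int (card (claims p))"
    using d9 by (intro mult_right_mono) auto
  ultimately show ?thesis by (simp add: outer_def)
qed

lemma outer_contact:
  assumes "H \<in> \<B>" "p \<in> H" "z \<in> bd H" "p \<in> N z" "\<not> demanding H z"
  shows "int (card (N z - H - bd H)) \<le> outer H p"
proof -
  have "(d - 1) * card (claims p) + card (N z - H - bd H) \<le> card (N2 p - H - bd H)"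
    using outer_ge_contact assms unfolding demanding_def by blast
  then have "int (d - 1) * int (card (claims p)) + int (card (N z - H - bd H)) \<le> int (card (N2 p - H - bd H))"
    by (metis of_nat_le_iff of_nat_mult of_nat_add)
  moreover have "(int d - 5) * int (card (claims p)) \<le> int (d - 1) * int (card (claims p))"
    using d9 by (intro mult_right_mono) auto
  ultimately show ?thesis by (simp add: outer_def)
qed

lemma surplus:
  assumes H: "H \<in> \<B>" and z: "z \<in> bd H" "\<not> demanding H z"
  shows "int (card (N z \<inter> H)) * int (card (N z - H - bd H)) \<le> (\<Sum>c\<in>H. outer H c)"
proof -
  have finH: "finite H" using family_subset[OF H] finite_subset_V by blast
  have "int (card (N z \<inter> H)) * int (card (N z - H - bd H)) = (\<Sum>c\<in>N z \<inter> H. int (card (N z - H - bd H)))"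
    by simp
  also have "\<dots> \<le> (\<Sum>c\<in>N z \<inter> H. outer H c)"
    by (intro sum_mono outer_contact[OF H]) (use z in auto)
  also have "\<dots> \<le> (\<Sum>c\<in>H. outer H c)"
    by (intro sum_mono2 finH) (use outer_nonneg[OF H] in auto)
  finally show ?thesis .
qed

lemma gain_ineq:
  assumes H: "H \<in> \<B>" and T: "T \<subseteq> bd H" and s: "card H = d + 1 + s"
  shows "(int s + int (card T)) * (int d + 1 + int s) - 5 * int (card T) + (\<Sum>c\<in>H. outer H c) \<le> (\<Sum>c\<in>H. gain c)"
proof -
  have "(card H - (d + 1) + card T) * card H + (\<Sum>c\<in>H. card (N2 c - H - bd H))
      \<le> (\<Sum>c\<in>H. card (N2 c)) + 5 * card T"
    by (rule block_ineq[OF blocks[OF H] T])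
  moreover have "card H - (d + 1) = s" using s by simp
  ultimately have "(s + card T) * (d + 1 + s) + (\<Sum>c\<in>H. card (N2 c - H - bd H))
      \<le> (\<Sum>c\<in>H. card (N2 c)) + 5 * card T"
    using s by metis
  then have "int ((s + card T) * (d + 1 + s) + (\<Sum>c\<in>H. card (N2 c - H - bd H)))
      \<le> int ((\<Sum>c\<in>H. card (N2 c)) + 5 * card T)"
    by (simp only: of_nat_le_iff)
  then have "(int s + int (card T)) * (int d + 1 + int s) + (\<Sum>c\<in>H. int (card (N2 c - H - bd H)))
      \<le> (\<Sum>c\<in>H. int (card (N2 c))) + 5 * int (card T)"
    by (simp only: of_nat_add of_nat_mult of_nat_sum of_nat_1 of_nat_numeral)
  then show ?thesis by (simp add: gain_def outer_def sum_subtractf)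
qed

lemma contact_numbers:
  assumes "H \<in> \<B>" "z \<in> bd H"
  shows "int d + 1 - int (card (bd H)) \<le> int (card (N z \<inter> H)) + int (card (N z - H - bd H))"
    "1 \<le> card (N z \<inter> H)"
proof -
  have zV: "z \<in> V" "N z \<inter> H \<noteq> {}" using assms by (auto simp: bd_def)
  have "N z - H \<subseteq> (bd H - {z}) \<union> (N z - H - bd H)" using N_irrefl by blast
  then have "card (N z - H) \<le> card ((bd H - {z}) \<union> (N z - H - bd H))" by (intro card_mono) auto
  also have "\<dots> \<le> card (bd H - {z}) + card (N z - H - bd H)" by (rule card_Un_le)
  also have "card (bd H - {z}) = card (bd H) - 1" using assms by simp
  finally have "card (N z - H) \<le> card (bd H) - 1 + card (N z - H - bd H)" .
  moreover have "card (bd H) \<ge> 1" using assms by (metis One_nat_def Suc_leI card_gt_0_iff empty_iff finite_bd)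
  ultimately show "int d + 1 - int (card (bd H)) \<le> int (card (N z \<inter> H)) + int (card (N z - H - bd H))"
    using card_N_split[OF zV(1), of H] by linarith
  show "1 \<le> card (N z \<inter> H)" using zV by (simp add: Suc_leI card_gt_0_iff)
qed

text \<open>
  Each demanding boundary vertex contributes exactly one edge leaving \<open>H\<close>; the handshake lemma then
  rules out most cases in which no boundary vertex is free of demands.
\<close>

lemma all_demanding_parity:
  assumes "H \<in> \<B>" "\<forall>z\<in>bd H. demanding H z"
  shows "even (d * card H + card (bd H))"
proof -
  have "(\<Sum>z\<in>bd H. card (N z \<inter> H)) = (\<Sum>z\<in>bd H. 1)"
    using assms demanding_card by (intro sum.cong) auto
  then show ?thesis using exits_parity[OF family_subset[OF assms(1)]] by simp
qed

text \<open>Parity makes \<open>d\<close> even, which excludes type B, so the claim comes from a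
  type A block \<open>B\<close>. Its two contacts already fill \<open>bd H\<close>, hence
  \<open>B\<close> and \<open>H\<close> are the two parts of a peanut.\<close>

lemma all_demanding_peanut:
  assumes H: "H \<in> \<B>" and dem_all: "\<forall>z\<in>bd H. demanding H z" and cH: "card H = d + 2" and t: "card (bd H) = 2"
  shows peanut
proof -
  have ev: "even d" using all_demanding_parity[OF H dem_all] cH t by simp
  obtain z where z: "z \<in> bd H" using t by fastforce
  obtain p B where p: "p \<in> H" "B \<in> claims p" "z \<in> M B" using dem_all z by (auto simp: demanding_def)
  have BD: "B \<in> D" "pt B = p" using p by (auto simp: claims_def)
  have "\<not> typeB B" using typeB_odd[OF family_subset] BD ev by (auto simp: D_def)
  then have B: "typeA B" "M B = B" using demand_D[OF BD(1)] by (auto simp: demand_def)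
  have BB: "B \<in> \<B>" "B \<subseteq> V" using BD family_subset by (auto simp: D_def)
  have HB: "B \<inter> H = {}" using claimed_avoids_block[OF H p(1,2)] B by simp
  obtain w w' v where w: "w \<in> B" "w' \<in> B" "w \<noteq> w'" "w' \<notin> N w" "bd B = {v}" "N w - B = {v}" "N w' - B = {v}"
    "N v \<inter> B = {w, w'}" "\<forall>p\<in>B - {w, w'}. N p \<subseteq> B"
    by (rule typeA_ends[OF BB(2) B(1)])
  have vp: "v = p" using w(5) bd_M[OF BD(1)] BD B by simp
  have "{w, w'} \<subseteq> bd H"
    using bd_I[of p H] w(1,2,8) vp p(1) HB by blast
  moreover have "card {w, w'} = card (bd H)" using w(3) t by simp
  ultimately have bdH: "bd H = {w, w'}" using card_subset_eq[OF finite_bd] by metis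
  have V: "V = B \<union> H"
  proof (rule ccontr)
    assume "V \<noteq> B \<union> H"
    moreover have "B \<union> H \<subseteq> V" "B \<union> H \<noteq> {}" using BB family_subset[OF H] p(1) by auto
    ultimately obtain a b where ab: "a \<in> B \<union> H" "b \<in> V - (B \<union> H)" "b \<in> N a" using cut[of "B \<union> H"] by metis
    then have "b \<in> bd B \<or> b \<in> bd H" using bd_I by blast
    then have "b = p \<or> b = w \<or> b = w'" using w(5) vp bdH by auto
    then show False using ab(2) w(1,2) p(1) by auto
  qed
  have out: "N p - H = {w, w'}"
  proof
    show "N p - H \<subseteq> {w, w'}" using out_subset_bd[OF p(1)] bdH by simp
    have "{w, w'} \<subseteq> N p" using w(8) vp by blast
    then show "{w, w'} \<subseteq> N p - H" using w(1,2) HB by blast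
  qed
  have "N r \<subseteq> H" if r: "r \<in> H - {p}" for r
  proof
    fix q assume q: "q \<in> N r"
    show "q \<in> H"
    proof (rule ccontr)
      assume "q \<notin> H"
      then have "q \<in> bd H" using bd_I[of r H q] q r by blast
      then have "q \<in> {w, w'}" using bdH by simp
      moreover have "r \<in> N q - B" using q r N_sym HB by blast
      ultimately have "r = p" using w(6,7) vp by auto
      then show False using r by simp
    qed
  qed
  moreover have "card B = d + 1" using B by (simp add: typeA_def)
  moreover have "N w - B = {p}" "N w' - B = {p}" using w(6,7) vp by simp_all
  ultimately have "peanut_parts B H w w' p"
    unfolding peanut_parts_def using V HB cH w(1-4,9) p(1) out by (intro conjI) simp_all
  then show ?thesis unfolding peanut_def using ev by blast
qed

lemma gain_ordinary:
  assumes H: "H \<in> \<B>" and types: "\<not> typeA H" "\<not> typeB H" "\<not> seg H" and nopeanut: "\<not> peanut"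
  shows "4 * int (card H) - 20 \<le> (\<Sum>c\<in>H. gain c)"
proof -
  note blk = blocks[OF H, unfolded block_def]
  define s where "s = card H - (d + 1)"
  have cH: "card H = d + 1 + s" using blk s_def by simp
  let ?t = "card (bd H)" and ?O = "\<Sum>c\<in>H. outer H c"
  let ?a = "\<lambda>z. int (card (N z \<inter> H))" and ?b = "\<lambda>z. int (card (N z - H - bd H))"
  have O: "0 \<le> ?O" by (intro sum_nonneg outer_nonneg[OF H])
  have t0: "1 \<le> ?t" using blk by (simp add: Suc_leI card_gt_0_iff)
  show ?thesis
  proof (cases "s + ?t \<le> 3")
    case False
    \<comment> \<open>The choice \<open>s + card T = 4\<close> gives the factor \<open>4\<close> at
      an error of at most \<open>20\<close>. For \<open>s \<ge> 4\<close> truncated subtraction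
      makes \<open>T\<close> empty.\<close>
    have "4 - s \<le> ?t" using False by simp
    then obtain T where T: "T \<subseteq> bd H" "card T = 4 - s" using obtain_subset_with_card_n by metis
    note g = gain_ineq[OF H T(1) cH, unfolded T(2)]
    show ?thesis
    proof (cases "s \<le> 4")
      case True
      then have "int (4 - s) = 4 - int s" by simp
      then show ?thesis using g O cH True by simp
    next
      case s5: False
      then have "4 * (int d + 1 + int s) \<le> int s * (int d + 1 + int s)"
        by (intro mult_right_mono) auto
      then show ?thesis using g O cH s5 by simp
    qed
  next
    case True
    have b: "2 \<le> ?b z" if "z \<in> bd H" for z
      using blk that True cH by (simp add: numeral_le_iff)
    have g: "(int s + int ?t) * (int d + 1 + int s) - 5 * int ?t + ?O \<le> (\<Sum>c\<in>H. gain c)"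
      by (rule gain_ineq[OF H order_refl cH])
    \<comment> \<open>From here on the missing \<open>4 - s - ?t\<close> multiples of
      \<open>card H\<close>, up to the error terms, must come from the far pairs at one boundary
      vertex free of demands.\<close>
    have key: "m * (int d + 1 - int ?t - m) \<le> ?O"
      if z: "z \<in> bd H" "\<not> demanding H z" "m \<le> ?a z" "m \<le> ?b z" "0 \<le> m" for z m
      using mult_lower_bound[OF z(3,4) contact_numbers(1)[OF H z(1)] z(5)] surplus[OF H z(1,2)] by linarith
    have key1: "int d - int ?t \<le> ?O" if "\<exists>z\<in>bd H. \<not> demanding H z"
      using key[of _ 1] that contact_numbers(2)[OF H] b by fastforce
    have key2: "m * (int d + 1 - int ?t - m) \<le> ?O"
      if z: "z \<in> bd H" "card (N z \<inter> H) \<noteq> 1" "m \<le> ?a z" "m \<le> ?b z" "0 \<le> m" for z m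
      using key[of z m] z demanding_card[OF H z(1)] by blast
    consider "s = 0" "?t = 1" | "s = 0" "?t = 2" | "s = 0" "?t = 3" | "s = 1" "?t = 1" | "s = 1" "?t = 2" | "s = 2" "?t = 1"
      using True t0 by linarith
    then show ?thesis
    proof cases
      case 1
      obtain z where z: "bd H = {z}" using 1 by (auto simp: card_1_singleton_iff)
      have "3 \<le> ?b z" using blk z 1 cH by simp
      have a2: "card (N z \<inter> H) \<noteq> 2" using types(1) z 1 cH by (simp add: typeA_def)
      \<comment> \<open>A single edge would make \<open>c\<close> the only vertex of
        \<open>H\<close> with an exit, against \<open>missed_has_exit\<close>.\<close>
      have a1: "card (N z \<inter> H) \<noteq> 1"
      proof
        assume "card (N z \<inter> H) = 1"
        then obtain c where c: "N z \<inter> H = {c}" by (auto simp: card_1_singleton_iff)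
        then have "c \<in> H" "z \<in> N c" "z \<notin> H" using N_sym z by (auto simp: bd_def)
        then obtain p where p: "p \<in> H" "p \<noteq> c" "\<not> N p \<subseteq> H"
          using missed_has_exit[OF family_subset[OF H], of c] cH 1 by auto
        then obtain q where q: "q \<in> N p" "q \<notin> H" by blast
        then have "q \<in> bd H" using bd_I[OF p(1)] by blast
        then have "z \<in> N p" using z q by simp
        then show False using p c N_sym by blast
      qed
      have "1 \<le> card (N z \<inter> H)" by (rule contact_numbers(2)[OF H]) (simp add: z)
      then have "3 \<le> ?a z" using a1 a2 by linarith
      then have "3 * (int d + 1 - int ?t - 3) \<le> ?O"
        using key2[of z 3] a1 z \<open>3 \<le> ?b z\<close> by simp
      then show ?thesis using g cH 1 by simp
    next
      case 2
      \<comment> \<open>\<open>H\<close> is no segment, so some boundary vertex has two neighbours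
        in \<open>H\<close>, and hence cannot be demanding.\<close>
      then obtain z where z: "z \<in> bd H" "card (N z \<inter> H) \<noteq> 1" using types(3) cH by (auto simp: seg_def)
      have "2 \<le> ?a z" using z contact_numbers(2)[OF H z(1)] by linarith
      then have "2 * (int d + 1 - int ?t - 2) \<le> ?O" using key2[OF z, where m = 2] b[OF z(1)] by simp
      then show ?thesis using g cH 2 by simp
    next
      case 3
      have "\<exists>z\<in>bd H. \<not> demanding H z"
      proof (rule ccontr)
        assume "\<not> ?thesis"
        then have "even (d * (d + 1) + 3)" using all_demanding_parity[OF H] 3 cH by simp
        then show False by simp
      qed
      then show ?thesis using key1 g cH 3 by simp
    next
      case 4
      then obtain z where z: "bd H = {z}" by (auto simp: card_1_singleton_iff)
      have a1: "card (N z \<inter> H) \<noteq> 1" using types(2) z 4 cH by (simp add: typeB_def)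
      have zb: "z \<in> bd H" using z by simp
      have "2 \<le> ?a z" using a1 contact_numbers(2)[OF H zb] by linarith
      then have "2 * (int d + 1 - int ?t - 2) \<le> ?O" using key2[OF zb a1, where m = 2] b[OF zb] by simp
      then show ?thesis using g cH 4 by simp
    next
      case 5
      have "\<exists>z\<in>bd H. \<not> demanding H z"
        using all_demanding_peanut[OF H] nopeanut 5 cH by auto
      then show ?thesis using key1 g cH 5 by simp
    next
      case 6
      have "\<exists>z\<in>bd H. \<not> demanding H z"
      proof (rule ccontr)
        assume "\<not> ?thesis"
        then have "even (d * (d + 3) + 1)" using all_demanding_parity[OF H] 6 cH by simp
        then show False by simp
      qed
      then show ?thesis using key1 g cH 6 by simp
    qed
  qed
qed

lemma no_demand_special:
  assumes "H \<in> \<B>" "typeA H \<or> typeB H \<or> seg H" "p \<in> H"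
  shows "claims p = {}"
proof -
  have "pt B \<noteq> p" if "B \<in> D" for B
    using demand_D[OF that] assms unfolding demand_def by blast
  then show ?thesis by (auto simp: claims_def)
qed

text \<open>No vertex of a special block pays a demand, so all boundary vertices yield their
  surplus. For a segment the two ends contribute \<open>2 * (d - 2)\<close>, which is enough; types
  A and B stay short, but by less than the \<open>d - 5\<close> that they claim.\<close>

lemma gain_special:
  assumes H: "H \<in> \<B>"
  shows "seg H \<Longrightarrow> 4 * int (card H) - 20 \<le> (\<Sum>c\<in>H. gain c)"
    "typeA H \<or> typeB H \<Longrightarrow> 4 * int (card H) - 20 - (int d - 5) \<le> (\<Sum>c\<in>H. gain c)"
proof -
  have nd: "\<not> demanding H z" if "typeA H \<or> typeB H \<or> seg H" for z
    using no_demand_special[OF H that] by (auto simp: demanding_def)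
  let ?b = "\<lambda>z. int (card (N z - H - bd H))"
  show "4 * int (card H) - 20 \<le> (\<Sum>c\<in>H. gain c)" if S: "seg H"
  proof -
    have cH: "card H = d + 1 + 0" "card (bd H) = 2" using S by (auto simp: seg_def)
    obtain c c' z z' where c: "c \<in> H" "c' \<in> H" "c \<noteq> c'" "z \<noteq> z'" "bd H = {z, z'}"
      "N c - H = {z}" "N c' - H = {z'}" "N z \<inter> H = {c}" "N z' \<inter> H = {c'}" "\<forall>p\<in>H - {c, c'}. N p \<subseteq> H"
      by (rule seg_ends[OF family_subset[OF H] S])
    have fin: "finite H" using family_subset[OF H] finite_subset_V by blast
    have z: "z \<in> bd H" "z' \<in> bd H" using c by auto
    have "int d - 2 \<le> ?b z" "int d - 2 \<le> ?b z'"
      using contact_numbers(1)[OF H z(1)] contact_numbers(1)[OF H z(2)] cH c(8,9) by auto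
    moreover have "?b z \<le> outer H c" "?b z' \<le> outer H c'"
    proof -
      have "c \<in> N z" "c' \<in> N z'" using c(8,9) by blast+
      then show "?b z \<le> outer H c" "?b z' \<le> outer H c'"
        using outer_contact[OF H c(1) z(1)] outer_contact[OF H c(2) z(2)] nd S by blast+
    qed
    moreover have "(\<Sum>p\<in>{c, c'}. outer H p) \<le> (\<Sum>p\<in>H. outer H p)"
      by (rule sum_mono2[OF fin]) (use c outer_nonneg[OF H] in auto)
    ultimately have "2 * (int d - 2) \<le> (\<Sum>p\<in>H. outer H p)" using c(3) by simp
    then show ?thesis using gain_ineq[OF H order_refl cH(1)] cH by simp
  qed
  show "4 * int (card H) - 20 - (int d - 5) \<le> (\<Sum>c\<in>H. gain c)" if AB: "typeA H \<or> typeB H"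
  proof (cases "typeA H")
    case True
    then have cH: "card H = d + 1 + 0" "card (bd H) = 1" by (auto simp: typeA_def)
    then obtain z where z: "z \<in> bd H" by fastforce
    have "card (N z \<inter> H) = 2" using True z by (simp add: typeA_def)
    then have "2 * (int d - 2) \<le> (\<Sum>p\<in>H. outer H p)"
      using surplus[OF H z nd] contact_numbers(1)[OF H z] cH True by auto
    then show ?thesis using gain_ineq[OF H order_refl cH(1)] cH by simp
  next
    case False
    then have B: "typeB H" using AB by simp
    then have cH: "card H = d + 1 + 1" "card (bd H) = 1" by (auto simp: typeB_def)
    then obtain z where z: "z \<in> bd H" by fastforce
    have "card (N z \<inter> H) = 1" using B z by (simp add: typeB_def)
    then have "int d - 1 \<le> (\<Sum>p\<in>H. outer H p)"
      using surplus[OF H z nd] contact_numbers(1)[OF H z] cH B by auto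
    then show ?thesis using gain_ineq[OF H order_refl cH(1)] cH by simp
  qed
qed

text \<open>Each demand has exactly one payer, so the payments lower the total gain by
  \<open>d - 5\<close> per member of \<open>D\<close>. The blocks in \<open>D\<close> are allowed
  the same shortfall, and the transfers cancel.\<close>

lemma sum_N2_ge:
  assumes cover: "\<And>u. u \<in> V \<Longrightarrow> card (N2 u) \<le> 3 \<Longrightarrow> u \<in> \<Union>\<B>" and nopeanut: "\<not> peanut"
  shows "4 * int (card V) - 20 * int (card \<B>) \<le> (\<Sum>p\<in>V. int (card (N2 p)))"
proof -
  have UV: "\<Union>\<B> \<subseteq> V" using family_subset by blast
  have finU: "finite (\<Union>\<B>)" using UV finite_subset_V by blast
  have finH: "finite H" if "H \<in> \<B>" for H using family_subset[OF that] finite_subset_V by blast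
  have dj: "\<forall>A\<in>\<B>. \<forall>B\<in>\<B>. A \<noteq> B \<longrightarrow> A \<inter> B = {}" using disjoint_blocks by (auto simp: disjoint_def)
  have 1: "4 * int (card H) - 20 - (if H \<in> D then int d - 5 else 0) \<le> (\<Sum>c\<in>H. gain c)" if "H \<in> \<B>" for H
    using gain_special[OF that] gain_ordinary[OF that _ _ _ nopeanut] that by (auto simp: D_def)
  have 2: "4 \<le> gain p" if p: "p \<in> V - \<Union>\<B>" for p
  proof (cases "claims p = {}")
    case True
    then show ?thesis using cover[of p] p by (fastforce simp: gain_def)
  next
    case False
    then have "1 \<le> int (card (claims p))" using finite_claims by (simp add: Suc_leI card_gt_0_iff)
    moreover have "(d - 1) * card (claims p) \<le> card (N2 p)"
      using card_claims_le[of p] card_mono[OF finite_N2, of "N2 p \<inter> \<Union>(M ` claims p)" p] by auto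
    then have "int (d - 1) * int (card (claims p)) \<le> int (card (N2 p))" by (metis of_nat_le_iff of_nat_mult)
    \<comment> \<open>The \<open>d - 1\<close> claimed pairs cover the price \<open>d - 5\<close>
      and leave the required four.\<close>
    moreover have "int (d - 1) = (int d - 5) + 4" using d9 by simp
    ultimately show ?thesis by (simp add: gain_def algebra_simps)
  qed
  have "(\<Sum>H\<in>\<B>. (if H \<in> D then int d - 5 else 0)) = (int d - 5) * int (card D)"
  proof -
    have "\<B> \<inter> D = D" by (auto simp: D_def)
    then show ?thesis using finite_\<B> by (simp add: sum.If_cases)
  qed
  moreover have "int (card (\<Union>\<B>)) = (\<Sum>H\<in>\<B>. int (card H))"
    using finH dj by (subst card_Union_disjoint) (auto simp: pairwise_def disjnt_def)
  ultimately have "4 * int (card (\<Union>\<B>)) - 20 * int (card \<B>) - (int d - 5) * int (card D)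
      = (\<Sum>H\<in>\<B>. 4 * int (card H) - 20 - (if H \<in> D then int d - 5 else 0))"
    by (simp add: sum_subtractf sum_distrib_left)
  also have "\<dots> \<le> (\<Sum>H\<in>\<B>. \<Sum>c\<in>H. gain c)" by (intro sum_mono 1)
  also have "\<dots> = (\<Sum>c\<in>\<Union>\<B>. gain c)" using sum.Union_disjoint[of \<B> gain] finH dj by simp
  finally have 3: "4 * int (card (\<Union>\<B>)) - 20 * int (card \<B>) - (int d - 5) * int (card D) \<le> (\<Sum>c\<in>\<Union>\<B>. gain c)" .
  have "4 * int (card (V - \<Union>\<B>)) = (\<Sum>p\<in>V - \<Union>\<B>. 4)" by simp
  also have "\<dots> \<le> (\<Sum>p\<in>V - \<Union>\<B>. gain p)" by (intro sum_mono 2)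
  finally have 4: "4 * int (card (V - \<Union>\<B>)) \<le> (\<Sum>p\<in>V - \<Union>\<B>. gain p)" .
  have "(\<Sum>p\<in>V. gain p) = (\<Sum>p\<in>V - \<Union>\<B>. gain p) + (\<Sum>c\<in>\<Union>\<B>. gain c)"
    by (rule sum.subset_diff[OF UV finite_V])
  moreover have "card V = card (V - \<Union>\<B>) + card (\<Union>\<B>)"
    using card_Diff_subset[OF finU UV] card_mono[OF finite_V UV] by simp
  moreover have "(\<Sum>p\<in>V. gain p) = (\<Sum>p\<in>V. int (card (N2 p))) - (int d - 5) * int (card D)"
  proof -
    have "(\<Sum>p\<in>V. card (claims p)) = (\<Sum>B\<in>D. card {p \<in> V. pt B = p})"
      unfolding claims_def by (rule double_count[OF finite_V finite_D])
    also have "\<dots> = (\<Sum>B\<in>D. 1)"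
    proof (rule sum.cong)
      fix B assume "B \<in> D"
      then have "{p \<in> V. pt B = p} = {pt B}" using pt_V by auto
      then show "card {p \<in> V. pt B = p} = 1" by simp
    qed simp
    finally have "(\<Sum>p\<in>V. int (card (claims p))) = int (card D)" by (metis card_eq_sum of_nat_sum)
    then show ?thesis by (simp add: gain_def sum_subtractf flip: sum_distrib_left)
  qed
  ultimately show ?thesis using 3 4 by simp
qed

end

end

context block_family
begin

lemma card_family_le: "(d + 1) * card \<B> \<le> card V"
proof -
  have finH: "finite H" if "H \<in> \<B>" for H using family_subset[OF that] finite_subset_V by blast
  have "(d + 1) * card \<B> = (\<Sum>H\<in>\<B>. d + 1)" by simp
  also have "\<dots> \<le> (\<Sum>H\<in>\<B>. card H)" by (intro sum_mono) (use blocks in \<open>auto simp: block_def\<close>)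
  also have "\<dots> = card (\<Union>\<B>)"
    by (rule card_Union_disjoint[symmetric]) (use disjoint_blocks finH in \<open>auto simp: disjoint_def pairwise_def disjnt_def\<close>)
  also have "\<dots> \<le> card V" using family_subset by (intro card_mono finite_V) blast
  finally show ?thesis .
qed

lemma family_total:
  assumes "9 \<le> d" "\<not> snake" "\<not> peanut" "\<And>u. u \<in> V \<Longrightarrow> card (N2 u) \<le> 3 \<Longrightarrow> u \<in> \<Union>\<B>"
  shows "4 * int (card V) - 20 * int (card \<B>) \<le> (\<Sum>p\<in>V. int (card (N2 p)))"
proof -
  have "\<forall>B. \<exists>Mx. B \<in> \<B> \<and> (typeA B \<or> typeB B) \<longrightarrow> demand \<B> B (fst Mx) (snd Mx)"
    using demand_typeA demand_typeB assms(2) by (metis fst_conv snd_conv)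
  then obtain F where F: "\<And>B. B \<in> \<B> \<Longrightarrow> typeA B \<or> typeB B \<Longrightarrow> demand \<B> B (fst (F B)) (snd (F B))"
    by metis
  interpret demand_family V N d \<B> "fst \<circ> F" "snd \<circ> F"
    by unfold_locales (simp add: F)
  show ?thesis using sum_N2_ge assms by blast
qed

end

text \<open>The witness \<open>m\<close> is the number of blocks.\<close>

theorem (in regular_graph) sum_N2_bound:
  assumes "9 \<le> d" "\<not> snake" "\<not> peanut" and V: "\<And>r. r \<in> V \<Longrightarrow> card (N2 r) \<le> 3 \<Longrightarrow> V \<noteq> ball r \<union> N2 r"
  shows "\<exists>m. (d + 1) * m \<le> card V \<and> 4 * int (card V) - 20 * int m \<le> (\<Sum>p\<in>V. int (card (N2 p)))"
proof -
  obtain \<B> where B: "\<forall>H\<in>\<B>. block H" "disjoint \<B>" "\<forall>u\<in>V. card (N2 u) \<le> 3 \<longrightarrow> u \<in> \<Union>\<B>"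
    using exists_block_family[OF assms(1) V] by blast
  interpret block_family V N d \<B>
    by unfold_locales (use B in auto)
  show ?thesis using card_family_le family_total assms B(3) by blast
qed

subsection \<open>Transfer to pair graphs\<close>

lemma all_pairs_eq: "all_pairs S = {{a, b} | a b. a \<in> S \<and> b \<in> S \<and> a \<noteq> b}"
  by (auto simp: all_pairs_def card_2_iff)

lemma perfect_matching_on_unique:
  assumes partner: "\<And>p. p \<in> P \<Longrightarrow> \<exists>q\<in>P. {x. R p x} = {q}" and sym: "\<And>p q. R p q \<Longrightarrow> R q p"
    and irrefl: "\<And>p. \<not> R p p"
  shows "perfect_matching_on P {{p, q} | p q. p \<in> P \<and> q \<in> P \<and> R p q}"
proof -
  let ?M = "{{p, q} | p q. p \<in> P \<and> q \<in> P \<and> R p q}"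
  have uniq: "q = q'" if "p \<in> P" "R p q" "R p q'" for p q q'
  proof -
    obtain r where "{x. R p x} = {r}" using partner[OF \<open>p \<in> P\<close>] by blast
    then have "q \<in> {r}" "q' \<in> {r}" using that by blast+
    then show ?thesis by simp
  qed
  have "\<Union>?M = P"
  proof
    show "P \<subseteq> \<Union>?M"
    proof
      fix p assume p: "p \<in> P"
      then obtain q where "q \<in> P" "R p q" using partner[OF p] by blast
      then show "p \<in> \<Union>?M" using p by blast
    qed
  qed blast
  moreover have "disjoint ?M"
  proof (rule disjointI)
    fix e e' assume e: "e \<in> ?M" "e' \<in> ?M" "e \<noteq> e'"
    obtain p q p' q' where pq: "e = {p, q}" "R p q" "p \<in> P" "q \<in> P" "e' = {p', q'}" "R p' q'" "p' \<in> P" "q' \<in> P"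
      using e(1,2) by blast
    show "e \<inter> e' = {}"
    proof (rule ccontr)
      assume "e \<inter> e' \<noteq> {}"
      then consider "p = p'" | "p = q'" | "q = p'" | "q = q'" using pq by blast
      then have "e = e'"
      proof cases
        case 1 then show ?thesis using pq uniq by metis
      next
        case 2 then show ?thesis using pq uniq sym by (metis insert_commute)
      next
        case 3 then show ?thesis using pq uniq sym by (metis insert_commute)
      next
        case 4 then show ?thesis using pq uniq sym by metis
      qed
      then show False using e by simp
    qed
  qed
  moreover have "\<forall>e\<in>?M. card e = 2"
  proof
    fix e assume "e \<in> ?M"
    then obtain p q where "e = {p, q}" "R p q" by blast
    moreover have "p \<noteq> q" using calculation irrefl by blast
    ultimately show "card e = 2" by simp
  qed
  moreover have "{} \<notin> ?M" by auto
  ultimately show ?thesis by (simp add: perfect_matching_on_def partition_on_def)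
qed

lemma card_edges_of_relation:
  assumes V: "finite V" and A: "\<And>u. A u \<subseteq> V" "\<And>u. u \<notin> A u" "\<And>u v. u \<in> A v \<Longrightarrow> v \<in> A u"
  shows "2 * card {{u, v} | u v. v \<in> A u} = (\<Sum>u\<in>V. card (A u))"
proof -
  let ?E = "{{u, v} | u v. v \<in> A u}"
  have "?E \<subseteq> Pow V" using A by blast
  then have finE: "finite ?E" using V finite_subset by blast
  have "(\<Sum>u\<in>V. card {e \<in> ?E. u \<in> e}) = (\<Sum>u\<in>V. card (A u))"
  proof (rule sum.cong)
    fix u
    have "{e \<in> ?E. u \<in> e} = (\<lambda>v. {u, v}) ` A u" using A(3) by (auto simp: doubleton_eq_iff)
    moreover have "inj_on (\<lambda>v. {u, v}) (A u)" by (auto simp: inj_on_def doubleton_eq_iff)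
    ultimately show "card {e \<in> ?E. u \<in> e} = card (A u)" by (simp add: card_image)
  qed simp
  moreover have "(\<Sum>u\<in>V. card {e \<in> ?E. u \<in> e}) = (\<Sum>e\<in>?E. card {u \<in> V. u \<in> e})"
    by (rule double_count[OF V finE])
  moreover have "(\<Sum>e\<in>?E. card {u \<in> V. u \<in> e}) = (\<Sum>e\<in>?E. 2)"
  proof (rule sum.cong)
    fix e assume "e \<in> ?E"
    then obtain u v where uv: "e = {u, v}" "v \<in> A u" by blast
    then have "{w \<in> V. w \<in> e} = {u, v}" "u \<noteq> v" using A by blast+
    then show "card {w \<in> V. w \<in> e} = 2" by simp
  qed simp
  ultimately show ?thesis by simp
qed

section \<open>Recovering snakes and peanuts from the numbers\<close>

locale regular_pair_graph = regular_graph V N d for V N and d +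
  fixes G :: "'a pair_pre_digraph"
  assumes verts: "pverts G = V" and arcs: "parcs G = {(u, v). v \<in> N u}"
begin

lemma edges_eq: "edges G = {{u, v} | u v. v \<in> N u}"
  by (simp add: edges_def arcs)

lemma edge_iff: "{u, v} \<in> edges G \<longleftrightarrow> v \<in> N u"
  using N_sym by (auto simp: edges_eq doubleton_eq_iff)

lemma edges_withinI:
  assumes "\<And>a b. a \<in> S \<Longrightarrow> b \<in> S \<Longrightarrow> a \<noteq> b \<Longrightarrow> b \<in> N a \<longleftrightarrow> {a, b} \<notin> F"
  shows "edges_within G S = all_pairs S - F"
proof -
  have "edges_within G S = {{a, b} | a b. a \<in> S \<and> b \<in> S \<and> b \<in> N a}"
    by (auto simp: edges_within_def edges_eq)
  also have "\<dots> = all_pairs S - F"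
  proof
    show "{{a, b} | a b. a \<in> S \<and> b \<in> S \<and> b \<in> N a} \<subseteq> all_pairs S - F"
    proof
      fix e assume "e \<in> {{a, b} | a b. a \<in> S \<and> b \<in> S \<and> b \<in> N a}"
      then obtain a b where ab: "e = {a, b}" "a \<in> S" "b \<in> S" "b \<in> N a" by blast
      moreover have "a \<noteq> b" using ab(4) N_irrefl by blast
      ultimately show "e \<in> all_pairs S - F" using assms[of a b] unfolding all_pairs_eq by blast
    qed
    show "all_pairs S - F \<subseteq> {{a, b} | a b. a \<in> S \<and> b \<in> S \<and> b \<in> N a}"
    proof
      fix e assume e: "e \<in> all_pairs S - F"
      then obtain a b where ab: "e = {a, b}" "a \<in> S" "b \<in> S" "a \<noteq> b" unfolding all_pairs_eq by blast
      then have "b \<in> N a" using assms[of a b] e by blast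
      then show "e \<in> {{a, b} | a b. a \<in> S \<and> b \<in> S \<and> b \<in> N a}" using ab by blast
    qed
  qed
  finally show ?thesis .
qed

lemma missed_single:
  assumes "H \<subseteq> V" "p \<in> H" "card H + card (N p - H) = d + 2"
  obtains q where "q \<in> H" "q \<noteq> p" "\<And>r. r \<in> H \<Longrightarrow> r \<noteq> p \<Longrightarrow> r \<notin> N p \<longleftrightarrow> r = q"
proof -
  have "card (H - N p - {p}) = 1" using card_missed[OF assms(1,2)] assms(3) by simp
  then obtain q where "H - N p - {p} = {q}" by (auto simp: card_1_singleton_iff)
  then show ?thesis by (intro that[of q]) blast+
qed

text \<open>
  Exactly two vertices of \<open>H\<close> have an edge out of \<open>H\<close>, one each, and they can only miss each other.
\<close>

lemma segment_missed:
  assumes H: "H \<subseteq> V" "card H = d + 1" and s: "s \<in> H" "s' \<in> H" "s \<noteq> s'"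
    and one: "card (N s - H) = 1" "card (N s' - H) = 1" and inner: "\<forall>p\<in>H - {s, s'}. N p \<subseteq> H"
  shows "edges_within G H = all_pairs H - {{s, s'}}"
proof (rule edges_withinI)
  have full: "b \<in> N a" if "a \<in> H - {s, s'}" "b \<in> H" "a \<noteq> b" for a b
  proof -
    have "card (N a - H) = 0" using inner that by (simp add: Diff_eq_empty_iff)
    then have "card (H - N a - {a}) = 0" using card_missed[OF H(1), of a] that H(2) by simp
    then show ?thesis using that H finite_subset_V by auto
  qed
  obtain q where q: "q \<in> H" "q \<noteq> s" "\<And>r. r \<in> H \<Longrightarrow> r \<noteq> s \<Longrightarrow> r \<notin> N s \<longleftrightarrow> r = q"
    using missed_single[OF H(1) s(1)] one H(2) by auto
  have "q = s'" using full[of q s] q s N_sym by blast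
  fix a b assume ab: "a \<in> H" "b \<in> H" "a \<noteq> b"
  consider "a \<noteq> s" "a \<noteq> s'" | "a = s" | "a = s'" "b \<noteq> s" | "a = s'" "b = s" by blast
  then show "b \<in> N a \<longleftrightarrow> {a, b} \<notin> {{s, s'}}"
  proof cases
    case 1
    then show ?thesis using full[of a b] ab by (auto simp: doubleton_eq_iff)
  next
    case 2
    then show ?thesis using q(3)[of b] ab \<open>q = s'\<close> s by (auto simp: doubleton_eq_iff)
  next
    case 3
    then show ?thesis using full[of b a] ab N_sym by (auto simp: doubleton_eq_iff)
  next
    case 4
    then have "s \<notin> N s'" using q(3)[of s'] s \<open>q = s'\<close> N_sym by blast
    then show ?thesis using 4 by (simp add: insert_commute)
  qed
qed

lemma segment_if_seg:
  assumes H: "H \<subseteq> V" "seg H" and s: "exit H s" "exit H s'" "s \<noteq> s'"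
  shows "segment d G H s s'"
proof -
  obtain c c' z z' where c: "c \<in> H" "c' \<in> H" "c \<noteq> c'" "z \<noteq> z'" "bd H = {z, z'}"
    "N c - H = {z}" "N c' - H = {z'}" "N z \<inter> H = {c}" "N z' \<inter> H = {c'}" "\<forall>p\<in>H - {c, c'}. N p \<subseteq> H"
    by (rule seg_ends[OF H])
  have sc: "s \<in> {c, c'}" "s' \<in> {c, c'}" using c(10) s by (auto simp: exit_def)
  then have eq: "{s, s'} = {c, c'}" using s(3) by auto
  have one: "card (N s - H) = 1" "card (N s' - H) = 1" using sc c(6,7) by auto
  have inner: "\<forall>p\<in>H - {s, s'}. N p \<subseteq> H" using c(10) eq by simp
  have "card H = d + 1" "s \<in> H" "s' \<in> H" using H s by (auto simp: seg_def exit_def)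
  then show ?thesis
    unfolding segment_def using segment_missed[OF H(1) _ _ _ s(3) one inner] s(3) by simp
qed

text \<open>At size \<open>d + 2\<close> a vertex without exits misses exactly one other. These
  missed pairs are the matching, except that the vertices of \<open>Q - P\<close> miss
  \<open>u\<close>.\<close>

lemma B_block_if_typeB:
  assumes H: "H \<subseteq> V" "typeB H" and u: "exit H u"
  shows "B_block d G H u"
proof -
  obtain u' z where e: "u' \<in> H" "bd H = {z}" "N u' - H = {z}" "N z \<inter> H = {u'}" "\<forall>p\<in>H - {u'}. N p \<subseteq> H"
    by (rule typeB_ends[OF H(2)])
  have u': "u' = u" using e(5) u by (auto simp: exit_def)
  have uH: "u \<in> H" using u by (simp add: exit_def)
  have finH: "finite H" using H(1) finite_subset_V by blast
  have cH: "card H = d + 2" using H by (simp add: typeB_def)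
  define Q where "Q = H - {u}"
  define P where "P = N u \<inter> H"
  define R where "R a b \<longleftrightarrow> a \<in> P \<and> b \<in> Q \<and> a \<noteq> b \<and> b \<notin> N a" for a b
  define M where "M = {{p, q} | p q. p \<in> P \<and> q \<in> P \<and> R p q}"
  have cP: "card P + 1 = d"
    using card_N_split[of u H] e(3) u' uH H(1) unfolding P_def by auto
  have PQ: "P \<subseteq> Q" using N_irrefl by (auto simp: P_def Q_def)
  have miss: "\<exists>q. q \<in> H \<and> q \<noteq> p \<and> (\<forall>r. r \<in> H \<longrightarrow> r \<noteq> p \<longrightarrow> (r \<notin> N p \<longleftrightarrow> r = q))" if p: "p \<in> Q" for p
  proof -
    have "card (N p - H) = 0" using e(5) p u' by (simp add: Q_def Diff_eq_empty_iff)
    then show ?thesis using missed_single[OF H(1), of p] p cH unfolding Q_def by (metis DiffD1 add.right_neutral)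
  qed
  \<comment> \<open>A vertex of \<open>Q - P\<close> already spends its only missed vertex on
    \<open>u\<close>.\<close>
  have inP: "b \<in> P" if ab: "a \<in> Q" "b \<in> Q" "a \<noteq> b" "b \<notin> N a" for a b
  proof (rule ccontr)
    assume "b \<notin> P"
    then have ub: "u \<notin> N b" using ab N_sym by (auto simp: P_def Q_def)
    have aNb: "a \<notin> N b" using ab N_sym by blast
    obtain q where q: "\<forall>r. r \<in> H \<longrightarrow> r \<noteq> b \<longrightarrow> (r \<notin> N b \<longleftrightarrow> r = q)" using miss[OF ab(2)] by blast
    have "u = q" using q ub uH ab(2) by (auto simp: Q_def)
    moreover have "a = q" using q aNb ab by (auto simp: Q_def)
    ultimately show False using ab(1) by (auto simp: Q_def)
  qed
  have "perfect_matching_on P M"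
    unfolding M_def
  proof (rule perfect_matching_on_unique)
    fix p assume p: "p \<in> P"
    obtain q where q: "q \<in> H" "q \<noteq> p" "\<forall>r. r \<in> H \<longrightarrow> r \<noteq> p \<longrightarrow> (r \<notin> N p \<longleftrightarrow> r = q)"
      using miss[of p] p PQ by blast
    have "q \<noteq> u" using q p uH N_sym by (auto simp: P_def)
    then have qQ: "q \<in> Q" using q by (simp add: Q_def)
    moreover have "q \<notin> N p" using q by blast
    ultimately have "q \<in> P" using inP[of p q] p PQ q by blast
    moreover have "{x. R p x} = {q}"
      using qQ q p by (auto simp: R_def Q_def)
    ultimately show "\<exists>q\<in>P. {x. R p x} = {q}" by blast
  next
    show "R q p" if "R p q" for p q
      using that inP[of p q] PQ N_sym unfolding R_def by blast
    show "\<not> R p p" for p by (simp add: R_def)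
  qed
  moreover have "edges_within G Q = all_pairs Q - M"
  proof (rule edges_withinI)
    fix a b assume ab: "a \<in> Q" "b \<in> Q" "a \<noteq> b"
    show "b \<in> N a \<longleftrightarrow> {a, b} \<notin> M"
    proof
      assume "b \<in> N a"
      then show "{a, b} \<notin> M" using N_sym by (auto simp: M_def R_def doubleton_eq_iff)
    next
      assume "{a, b} \<notin> M"
      then show "b \<in> N a" using inP[OF ab] inP[of b a] ab N_sym unfolding M_def R_def by blast
    qed
  qed
  moreover have "{v \<in> H. {u, v} \<in> edges G} = P" by (auto simp: edge_iff P_def)
  moreover have "card Q = d + 1" "card P = d - 1" "H = insert u Q" "u \<notin> Q"
    using cH uH finH cP by (auto simp: Q_def)
  ultimately show ?thesis unfolding B_block_def using PQ by blast
qed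

lemma snake_graph_if_snake:
  assumes snake
  shows "snake_graph d G"
proof -
  obtain j S a b where s: "chain j S a b" "typeB (S (Suc j))" "exit (S (Suc j)) (a (Suc j))"
    "S (Suc j) \<inter> \<Union>(S ` {0..j}) = {}" "V = \<Union>(S ` {0..Suc j})" "links (Suc j) S a b"
    using assms unfolding snake_def by blast
  have SV: "S i \<subseteq> V" if "i \<le> Suc j" for i using s(5) that by auto
  have "odd d" using typeB_odd[OF SV s(2)] by simp
  moreover have "B_block d G (S 0) (b 0)"
    using B_block_if_typeB[OF SV[of 0]] s(1) by (simp add: chain_def)
  moreover have "\<forall>i\<in>{1..j}. segment d G (S i) (a i) (b i)"
    using segment_if_seg[OF SV] s(1) by (simp add: chain_def)
  moreover have "B_block d G (S (j + 1)) (a (j + 1))"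
    using B_block_if_typeB[OF SV s(2,3)] by simp
  moreover have "disjoint_family_on S {0..j + 1}"
  proof -
    have "{0..j + 1} = insert (Suc j) {0..j}" by auto
    then show ?thesis using s(1,4) by (simp add: chain_def disjoint_family_on_insert)
  qed
  moreover have "pverts G = (\<Union>i\<in>{0..j + 1}. S i)" using s(5) verts by simp
  moreover have "edges G = (\<Union>i\<in>{0..j + 1}. edges_within G (S i)) \<union> {{b i, a (i + 1)} | i. i \<le> j}"
  proof
    show "edges G \<subseteq> (\<Union>i\<in>{0..j + 1}. edges_within G (S i)) \<union> {{b i, a (i + 1)} | i. i \<le> j}"
    proof
      fix e assume e: "e \<in> edges G"
      then obtain u v where uv: "e = {u, v}" "v \<in> N u" by (auto simp: edges_eq)
      have "u \<in> \<Union>(S ` {0..Suc j})" "v \<in> \<Union>(S ` {0..Suc j})"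
        using uv(2) N_in_V N_in_V' s(5) by auto
      then consider i where "i \<le> Suc j" "u \<in> S i" "v \<in> S i" | i where "i < Suc j" "{u, v} = {b i, a (Suc i)}"
        using s(6) uv(2) unfolding links_def by blast
      then show "e \<in> (\<Union>i\<in>{0..j + 1}. edges_within G (S i)) \<union> {{b i, a (i + 1)} | i. i \<le> j}"
      proof cases
        case (1 i)
        then have "e \<in> edges_within G (S i)" using e uv(1) by (simp add: edges_within_def)
        then show ?thesis using 1(1) by auto
      next
        case (2 i)
        then have "e = {b i, a (i + 1)}" "i \<le> j" using uv(1) by auto
        then show ?thesis by blast
      qed
    qed
    have "{b i, a (i + 1)} \<in> edges G" if "i \<le> j" for i
      using s(6) that by (simp add: links_def edge_iff)
    then show "(\<Union>i\<in>{0..j + 1}. edges_within G (S i)) \<union> {{b i, a (i + 1)} | i. i \<le> j} \<subseteq> edges G"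
      by (auto simp: edges_within_def)
  qed
  ultimately show ?thesis unfolding snake_graph_def by blast
qed

text \<open>In \<open>R2\<close>, of size \<open>d + 2\<close>, the vertex \<open>u\<close> has two
  exits and so misses three vertices, while all others miss exactly one. The vertices
  \<open>v1\<close>, \<open>v2\<close>, \<open>v3\<close> spend theirs on \<open>u\<close>, and the
  rest is matched up.\<close>

lemma peanut_graph_if_peanut:
  assumes peanut
  shows "peanut_graph d G"
proof -
  have ev: "even d" using assms by (simp add: peanut_def)
  obtain R1 R2 w1 w2 u where "peanut_parts R1 R2 w1 w2 u" using assms unfolding peanut_def by blast
  then have p: "V = R1 \<union> R2" "R1 \<inter> R2 = {}" "card R1 = d + 1" "card R2 = d + 2"
    "w1 \<noteq> w2" "w1 \<in> R1" "w2 \<in> R1" "w2 \<notin> N w1" "u \<in> R2" "N u - R2 = {w1, w2}" "N w1 - R1 = {u}" "N w2 - R1 = {u}"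
    "\<forall>p\<in>R1 - {w1, w2}. N p \<subseteq> R1" "\<forall>p\<in>R2 - {u}. N p \<subseteq> R2"
    unfolding peanut_parts_def by simp_all
  have R1V: "R1 \<subseteq> V" and R2V: "R2 \<subseteq> V" using p(1) by auto
  have w1: "edges_within G R1 = all_pairs R1 - {{w1, w2}}"
    by (rule segment_missed[OF R1V p(3,6,7,5) _ _ p(13)]) (use p(11,12) in auto)
  have "card (N u - R2) = 2" using p(10,5) by simp
  then have "card (R2 - N u - {u}) = 3" using card_missed[OF R2V p(9)] p(4) by simp
  then obtain v1 v2 v3 where v: "R2 - N u - {u} = {v1, v2, v3}" "v1 \<noteq> v2" "v1 \<noteq> v3" "v2 \<noteq> v3"
    by (auto simp: card_3_iff)
  define A where "A = R2 - {u, v1, v2, v3}"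
  define R where "R a b \<longleftrightarrow> a \<in> A \<and> b \<in> A \<and> a \<noteq> b \<and> b \<notin> N a" for a b
  define M where "M = {{p, q} | p q. p \<in> A \<and> q \<in> A \<and> R p q}"
  have A_iff: "p \<in> A \<longleftrightarrow> p \<in> R2 \<and> p \<in> N u" for p
  proof -
    have "p \<in> R2 - N u - {u} \<longleftrightarrow> p \<in> {v1, v2, v3}" using v(1) by simp
    then show ?thesis using N_irrefl[of u] unfolding A_def by auto
  qed
  have miss: "\<exists>q. q \<in> R2 \<and> q \<noteq> p \<and> (\<forall>r. r \<in> R2 \<longrightarrow> r \<noteq> p \<longrightarrow> (r \<notin> N p \<longleftrightarrow> r = q))"
    if r: "p \<in> R2 - {u}" for p
  proof -
    have "card (N p - R2) = 0" using p(14) r by (simp add: Diff_eq_empty_iff)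
    then show ?thesis using missed_single[OF R2V, of p] r p(4) by (metis DiffD1 add.right_neutral)
  qed
  have inA: "b \<in> A" if ab: "a \<in> R2 - {u}" "b \<in> R2 - {u}" "a \<noteq> b" "b \<notin> N a" for a b
  proof (rule ccontr)
    assume "b \<notin> A"
    then have ub: "u \<notin> N b" using ab N_sym A_iff by blast
    have ab': "a \<notin> N b" using ab N_sym by blast
    obtain q where q: "\<forall>r. r \<in> R2 \<longrightarrow> r \<noteq> b \<longrightarrow> (r \<notin> N b \<longleftrightarrow> r = q)" using miss[OF ab(2)] by blast
    have "u = q" using q ub p(9) ab(2) by auto
    moreover have "a = q" using q ab' ab by auto
    ultimately show False using ab(1) by auto
  qed
  have "perfect_matching_on A M"
    unfolding M_def
  proof (rule perfect_matching_on_unique)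
    fix r assume r: "r \<in> A"
    then have r2: "r \<in> R2 - {u}" by (simp add: A_def)
    obtain q where q: "q \<in> R2" "q \<noteq> r" "\<forall>x. x \<in> R2 \<longrightarrow> x \<noteq> r \<longrightarrow> (x \<notin> N r \<longleftrightarrow> x = q)"
      using miss[OF r2] by blast
    have "u \<in> N r" using r A_iff N_sym by blast
    moreover have "q \<notin> N r" using q by blast
    ultimately have "q \<noteq> u" by blast
    then have qA: "q \<in> A" using inA[of r q] r2 q \<open>q \<notin> N r\<close> by blast
    moreover have "{x. R r x} = {q}"
    proof
      show "{x. R r x} \<subseteq> {q}" using q(3) by (auto simp: R_def A_def)
      show "{q} \<subseteq> {x. R r x}" using qA r q(2) \<open>q \<notin> N r\<close> by (simp add: R_def)
    qed
    ultimately show "\<exists>q\<in>A. {x. R r x} = {q}" by blast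
  next
    show "R q p" if "R p q" for p q using that N_sym unfolding R_def by blast
    show "\<not> R p p" for p by (simp add: R_def)
  qed
  moreover have "edges_within G R2 = all_pairs R2 - ({{u, v1}, {u, v2}, {u, v3}} \<union> M)"
  proof (rule edges_withinI)
    have U: "b \<in> N u \<longleftrightarrow> {u, b} \<notin> {{u, v1}, {u, v2}, {u, v3}} \<union> M" if b: "b \<in> R2" "b \<noteq> u" for b
    proof -
      have "{u, b} \<notin> M" by (auto simp: M_def A_def doubleton_eq_iff)
      moreover have "b \<notin> N u \<longleftrightarrow> b \<in> {v1, v2, v3}" using v(1) b by blast
      ultimately show ?thesis using b(2) by (auto simp: doubleton_eq_iff)
    qed
    fix a b assume ab: "a \<in> R2" "b \<in> R2" "a \<noteq> b"
    consider "a = u" | "b = u" | "a \<noteq> u" "b \<noteq> u" by blast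
    then show "b \<in> N a \<longleftrightarrow> {a, b} \<notin> {{u, v1}, {u, v2}, {u, v3}} \<union> M"
    proof cases
      case 1
      then show ?thesis using U[of b] ab by simp
    next
      case 2
      then show ?thesis using U[of a] ab N_sym_iff[of u a] by (simp add: insert_commute)
    next
      case 3
      then have n: "{a, b} \<notin> {{u, v1}, {u, v2}, {u, v3}}" by (auto simp: doubleton_eq_iff)
      have "b \<in> N a \<longleftrightarrow> {a, b} \<notin> M"
      proof
        assume "b \<in> N a"
        then show "{a, b} \<notin> M" using N_sym by (auto simp: M_def R_def doubleton_eq_iff)
      next
        assume nM: "{a, b} \<notin> M"
        show "b \<in> N a"
        proof (rule ccontr)
          assume "b \<notin> N a"
          then have "a \<in> A" "b \<in> A" using inA[of a b] inA[of b a] ab 3 N_sym by blast+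
          then show False using nM ab \<open>b \<notin> N a\<close> unfolding M_def R_def by blast
        qed
      qed
      then show ?thesis using n by blast
    qed
  qed
  moreover have "edges G = edges_within G R1 \<union> edges_within G R2 \<union> {{u, w1}, {u, w2}}"
  proof
    have cross: "a \<in> {w1, w2} \<and> b = u" if "a \<in> R1" "b \<in> R2" "b \<in> N a" for a b
    proof -
      have bn: "b \<notin> R1" using that p(2) by blast
      then have "a \<in> {w1, w2}" using that p(13) by blast
      moreover have "b \<in> N a - R1" using that bn by blast
      ultimately show ?thesis using p(11,12) by auto
    qed
    show "edges G \<subseteq> edges_within G R1 \<union> edges_within G R2 \<union> {{u, w1}, {u, w2}}"
    proof
      fix e assume e: "e \<in> edges G"
      then obtain a b where ab: "e = {a, b}" "b \<in> N a" by (auto simp: edges_eq)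
      have "a \<in> R1 \<union> R2" "b \<in> R1 \<union> R2" using ab(2) N_in_V N_in_V' p(1) by blast+
      then consider "e \<subseteq> R1" | "e \<subseteq> R2" | "a \<in> R1" "b \<in> R2" | "b \<in> R1" "a \<in> R2" using ab(1) by blast
      then show "e \<in> edges_within G R1 \<union> edges_within G R2 \<union> {{u, w1}, {u, w2}}"
      proof cases
        case 3
        then show ?thesis using cross[of a b] ab by auto
      next
        case 4
        then show ?thesis using cross[of b a] ab N_sym by auto
      qed (use e in \<open>simp_all add: edges_within_def\<close>)
    qed
    have "w1 \<in> N u" "w2 \<in> N u" using p(10) by blast+
    then have "{u, w1} \<in> edges G" "{u, w2} \<in> edges G" by (simp_all add: edge_iff)
    then show "edges_within G R1 \<union> edges_within G R2 \<union> {{u, w1}, {u, w2}} \<subseteq> edges G"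
      by (auto simp: edges_within_def)
  qed
  moreover have "{v1, v2, v3} \<subseteq> R2 - {u}" using v(1) by blast
  then have "{u, v1, v2, v3} \<subseteq> R2" "distinct [u, v1, v2, v3]" using p(9) v(2-4) by auto
  ultimately have "pverts G = R1 \<union> R2 \<and> R1 \<inter> R2 = {} \<and> card R1 = d + 1 \<and> card R2 = d + 2 \<and>
     w1 \<in> R1 \<and> w2 \<in> R1 \<and> w1 \<noteq> w2 \<and>
     edges_within G R1 = all_pairs R1 - {{w1, w2}} \<and>
     {u, v1, v2, v3} \<subseteq> R2 \<and> distinct [u, v1, v2, v3] \<and>
     perfect_matching_on (R2 - {u, v1, v2, v3}) M \<and>
     edges_within G R2 = all_pairs R2 - ({{u, v1}, {u, v2}, {u, v3}} \<union> M) \<and>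
     edges G = edges_within G R1 \<union> edges_within G R2 \<union> {{u, w1}, {u, w2}}"
    using verts p(1-7) w1 unfolding A_def by (intro conjI) simp_all
  note R = this
  show ?thesis unfolding peanut_graph_def by (intro conjI[OF ev] exI, rule R)
qed

end

section \<open>Distances and edge counts in the square\<close>

lemma regular_pair_graph_of_pair_graph:
  assumes G: "pair_graph G" and conn: "Digraph_Component.connected (with_proj G)" and reg: "regular d G"
  shows "regular_pair_graph (pverts G) (\<lambda>u. {v. (u, v) \<in> parcs G}) d G"
proof -
  interpret pair_graph G by (rule G)
  have symm: "(u, v) \<in> parcs G \<Longrightarrow> (v, u) \<in> parcs G" for u v
    using arcs_symmetric by blast
  have sc: "strongly_connected (with_proj G)"
    using symmetric_connected_imp_strongly_connected[OF pair_sym_arcs conn] .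
  show ?thesis
  proof unfold_locales
    show "finite (pverts G)" by (rule pair_finite_verts)
    show "{w. (v, w) \<in> parcs G} \<subseteq> pverts G" for v using in_arcsD2 by blast
    show "v \<notin> {w. (v, w) \<in> parcs G}" for v using pair_no_loops by fastforce
    show "v \<in> {w. (u, w) \<in> parcs G}" if "u \<in> {w. (v, w) \<in> parcs G}" for u v
      using that symm by blast
    show "card {w. (v, w) \<in> parcs G} = d" if "v \<in> pverts G" for v
    proof -
      have "out_arcs (with_proj G) v = Pair v ` {w. (v, w) \<in> parcs G}"
        by (auto simp: out_arcs_def)
      then have "out_degree (with_proj G) v = card {w. (v, w) \<in> parcs G}"
        by (simp add: out_degree_def card_image inj_on_def)
      then show ?thesis using reg that by (simp add: regular_def)
    qed
    show "\<exists>u\<in>A. \<exists>v\<in>pverts G - A. v \<in> {w. (u, w) \<in> parcs G}"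
      if A: "A \<subseteq> pverts G" "A \<noteq> {}" "A \<noteq> pverts G" for A
    proof (rule ccontr)
      assume no: "\<not> ?thesis"
      obtain a b where ab: "a \<in> A" "b \<in> pverts G" "b \<notin> A" using A by blast
      have "a \<rightarrow>\<^sup>*\<^bsub>with_proj G\<^esub> b" using sc ab A(1) unfolding strongly_connected_def by auto
      then have "b \<in> A"
      proof (induction rule: reachable_induct)
        case base
        then show ?case using ab by simp
      next
        case (step x y)
        then show ?case using no in_arcsD2 by auto
      qed
      then show False using ab by simp
    qed
  qed simp_all
qed

lemma distance_le_2:
  assumes "pair_graph G" "u \<in> pverts G"
  shows "distance G u v \<le> 2 \<longleftrightarrow>
    u = v \<or> (u, v) \<in> parcs G \<or> (\<exists>w. (u, w) \<in> parcs G \<and> (w, v) \<in> parcs G)"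
proof -
  interpret pair_graph G by (rule assms(1))
  have cost: "awalk_cost (\<lambda>_. 1) p = real (length p)" for p
    by (induction p) (simp_all add: awalk_cost_def)
  show ?thesis
  proof
    assume le: "distance G u v \<le> 2"
    have "\<exists>p. awalk u p v \<and> length p \<le> 2"
    proof (rule ccontr)
      assume no: "\<not> ?thesis"
      \<comment> \<open>Costs are natural numbers, so without walks of length at most
        \<open>2\<close> the infimum is at least \<open>3\<close>, strictly above the assumed
        bound.\<close>
      have "ereal 3 \<le> \<mu> (\<lambda>_. 1) u v"
        unfolding \<mu>_def
      proof (rule INF_greatest)
        fix p assume "p \<in> {p. awalk u p v}"
        then have "\<not> length p \<le> 2" using no by blast
        then show "ereal 3 \<le> ereal (awalk_cost (\<lambda>_. 1) p)" by (simp add: cost)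
      qed
      then have "ereal 3 \<le> 2" using le unfolding distance_def by (rule order_trans)
      then show False by simp
    qed
    then obtain p where p: "awalk u p v" "length p \<le> 2" by blast
    then consider "p = []" | e where "p = [e]" | e e' where "p = [e, e']"
      by (cases p; cases "tl p") auto
    then show "u = v \<or> (u, v) \<in> parcs G \<or> (\<exists>w. (u, w) \<in> parcs G \<and> (w, v) \<in> parcs G)"
    proof cases
      case 1
      then show ?thesis using p by (simp add: awalk_def)
    next
      case (2 e)
      then show ?thesis using p by (cases e) (auto simp: awalk_def)
    next
      case (3 e e')
      then show ?thesis using p by (cases e; cases e') (auto simp: awalk_def)
    qed
  next
    assume r: "u = v \<or> (u, v) \<in> parcs G \<or> (\<exists>w. (u, w) \<in> parcs G \<and> (w, v) \<in> parcs G)"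
    have "\<exists>p. awalk u p v \<and> length p \<le> 2"
    proof -
      consider "u = v" | "(u, v) \<in> parcs G" | w where "(u, w) \<in> parcs G" "(w, v) \<in> parcs G" using r by blast
      then show ?thesis
      proof cases
        case 1
        then show ?thesis using assms(2) by (intro exI[of _ "[]"]) (simp add: awalk_def)
      next
        case 2
        then show ?thesis using assms(2) by (intro exI[of _ "[(u, v)]"]) (simp add: awalk_def)
      next
        case (3 w)
        then show ?thesis using assms(2) by (intro exI[of _ "[(u, w), (w, v)]"]) (simp add: awalk_def)
      qed
    qed
    then obtain p where p: "awalk u p v" "length p \<le> 2" by blast
    have "\<mu> (\<lambda>_. 1) u v \<le> ereal (real (length p))"
      using min_cost_le_walk_cost[OF p(1), of "\<lambda>_. 1"] cost by simp
    also have "\<dots> \<le> 2" using p(2) by simp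
    finally show "distance G u v \<le> 2" by (simp add: distance_def)
  qed
qed

context regular_pair_graph
begin

lemma card_Un_N_N2: "card (N u \<union> N2 u) = card (N u) + card (N2 u)"
  by (rule card_Un_disjoint[OF finite_N finite_N2]) (auto simp: N2_def)

lemma parcs_square:
  assumes "pair_graph G"
  shows "parcs (square G) = {(u, v). v \<in> N u \<union> N2 u}"
proof -
  have "u \<in> V \<and> v \<in> V \<and> u \<noteq> v \<and> distance G u v \<le> 2 \<longleftrightarrow> v \<in> N u \<union> N2 u" for u v
  proof (cases "u \<in> V")
    case True
    have "(\<exists>w. w \<in> N u \<and> v \<in> N w) \<longleftrightarrow> N u \<inter> N v \<noteq> {}" using N_sym by blast
    then show ?thesis
      using distance_le_2[OF assms, of u v] True verts arcs N_irrefl[of u] N_in_V[of v u]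
      by (auto simp: N2_def)
  next
    case False
    then have "N u = {}" using N_in_V' by blast
    then show ?thesis using False by (simp add: N2_def)
  qed
  then show ?thesis by (simp add: square_def verts)
qed

lemma num_edges_square:
  assumes "pair_graph G"
  shows "2 * (real (num_edges (square G)) - real (num_edges G)) = (\<Sum>u\<in>V. real (card (N2 u)))"
proof -
  have "2 * num_edges G = (\<Sum>u\<in>V. card (N u))"
    unfolding num_edges_def edges_eq
    by (rule card_edges_of_relation[OF finite_V]) (use N_subset N_irrefl N_sym in auto)
  moreover have "2 * num_edges (square G) = (\<Sum>u\<in>V. card (N u \<union> N2 u))"
    unfolding num_edges_def edges_def parcs_square[OF assms] mem_Collect_eq case_prod_conv
  proof (rule card_edges_of_relation[OF finite_V])
    show "N u \<union> N2 u \<subseteq> V" for u using N_subset by (auto simp: N2_def)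
    show "u \<notin> N u \<union> N2 u" for u using N_irrefl by (simp add: N2_def)
    show "v \<in> N u \<union> N2 u" if "u \<in> N v \<union> N2 v" for u v
    proof -
      have "v \<in> V" using that N_in_V' by (auto simp: N2_def)
      then show ?thesis using that N_sym N2_sym by blast
    qed
  qed
  ultimately have "2 * num_edges (square G) = 2 * num_edges G + (\<Sum>u\<in>V. card (N2 u))"
    by (simp add: card_Un_N_N2 sum.distrib)
  then have "real (2 * num_edges (square G)) = real (2 * num_edges G + (\<Sum>u\<in>V. card (N2 u)))"
    by (rule arg_cong)
  then show ?thesis by simp
qed

lemma far_pair:
  assumes "pair_graph G" "\<not> complete_graph (square G)"
  obtains u v where "u \<in> V" "v \<in> V" "u \<noteq> v" "v \<notin> N u" "N u \<inter> N v = {}"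
proof -
  have "pverts (square G) = V" by (simp add: square_def verts)
  then have "parcs (square G) \<noteq> {(u, v). (u, v) \<in> V \<times> V \<and> u \<noteq> v}"
    using assms(2) finite_V unfolding complete_graph_def complete_digraph_pair_def by simp
  moreover have "parcs (square G) \<subseteq> {(u, v). (u, v) \<in> V \<times> V \<and> u \<noteq> v}"
    by (auto simp: square_def verts)
  ultimately obtain u v where "u \<in> V" "v \<in> V" "u \<noteq> v" "v \<notin> N u \<union> N2 u"
    unfolding parcs_square[OF assms(1)] by blast
  then show ?thesis using that by (auto simp: N2_def)
qed

lemma far_pair_card:
  assumes "u \<in> V" "v \<in> V" "u \<noteq> v" "v \<notin> N u" "N u \<inter> N v = {}"
  shows "2 * d + 2 \<le> card V"
proof -
  have "card (N u) + card (N v) = card (N u \<union> N v)" using assms(5) by (subst card_Un_disjoint) auto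
  also have "\<dots> \<le> card (V - {u, v})"
    using N_subset N_irrefl N_sym assms(4) finite_V by (intro card_mono) auto
  also have "\<dots> + 2 = card V"
  proof -
    have "card {u, v} \<le> card V" using assms finite_V by (intro card_mono) auto
    then show ?thesis using assms(1-3) by (subst card_Diff_subset) auto
  qed
  finally show ?thesis using assms card_N by simp
qed

text \<open>By connectivity the ball has a boundary, and the boundary of a ball consists of second
  neighbours of its centre.\<close>

lemma N2_nonempty:
  assumes "2 * d + 2 \<le> card V" "0 < d" "r \<in> V"
  shows "1 \<le> card (N2 r)"
proof (rule ccontr)
  assume "\<not> ?thesis"
  then have "N2 r = {}" by (simp add: not_le)
  moreover have "bd (ball r) \<subseteq> N2 r"
  proof
    fix z assume "z \<in> bd (ball r)"
    then obtain c where "z \<notin> ball r" "c \<in> ball r" "z \<in> N c" using N_sym by (auto simp: bd_def)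
    then show "z \<in> N2 r" using N_ball_subset[of c r] assms(3) by blast
  qed
  ultimately have "ball r = V" using bd_nonempty[OF ball_subset[OF assms(3)]] by (auto simp: ball_def)
  then show False using card_ball[OF assms(3)] assms by simp
qed

end

text \<open>Of the loss \<open>20 * n / (d + 1)\<close>, the part \<open>8 * n / (d + 1)\<close> is
  the first fraction exactly; strictness comes from enlarging \<open>12 * n / (d + 1)\<close> to
  \<open>12 * n / (d - 3)\<close>.\<close>

lemma deficit_bound:
  fixes n m F d :: real
  assumes "9 \<le> d" "0 < n" "(d + 1) * m \<le> n" "4 * n - 20 * m \<le> F"
  shows "4 * n * (1 - 2 / (d + 1) - 3 / (d - 3)) < F"
proof -
  have "m \<le> n / (d + 1)" using assms by (simp add: pos_le_divide_eq mult.commute)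
  moreover have "n / (d + 1) < n / (d - 3)" using assms by (intro divide_strict_left_mono) auto
  ultimately have "20 * m < 8 * (n / (d + 1)) + 12 * (n / (d - 3))" by linarith
  moreover have "4 * n * (1 - 2 / (d + 1) - 3 / (d - 3)) = 4 * n - 8 * (n / (d + 1)) - 12 * (n / (d - 3))"
    by (simp add: algebra_simps)
  ultimately show ?thesis using assms(4) by linarith
qed

theorem theorem1p2:
  fixes G :: "'a pair_pre_digraph" and d n :: nat
  assumes "d > 6"
    and "pair_graph G"
    and "Digraph_Component.connected (with_proj G)"
    and "regular d G"
    and "n = card (pverts G)"
    and "\<not> complete_graph (square G)"
    and "\<not> snake_graph d G"
    and "\<not> peanut_graph d G"
  shows "real (num_edges (square G)) - real (num_edges G)
           > 2 * real n * (1 - 2 / (real d + 1) - 3 / (real d - 3))"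
proof -
  let ?N = "\<lambda>u. {v. (u, v) \<in> parcs G}"
  interpret regular_pair_graph "pverts G" ?N d G
    by (rule regular_pair_graph_of_pair_graph[OF assms(2-4)])
  let ?F = "\<Sum>u\<in>pverts G. real (card (N2 u))"
  obtain u v where "u \<in> pverts G" "v \<in> pverts G" "u \<noteq> v" "v \<notin> ?N u" "?N u \<inter> ?N v = {}"
    by (rule far_pair[OF assms(2,6)])
  then have big: "2 * d + 2 \<le> n" using far_pair_card assms(5) by metis
  have "4 * real n * (1 - 2 / (real d + 1) - 3 / (real d - 3)) < ?F"
  proof (cases "9 \<le> d")
    case True
    \<comment> \<open>Otherwise \<open>2 * d + 2 \<le> n \<le> (d + 1) + 3\<close>.\<close>
    have "pverts G \<noteq> ball r \<union> N2 r" if r: "r \<in> pverts G" "card (N2 r) \<le> 3" for r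
    proof
      assume "pverts G = ball r \<union> N2 r"
      then have "n \<le> card (ball r) + card (N2 r)" using card_Un_le[of "ball r" "N2 r"] assms(5) by simp
      then show False using card_ball[OF r(1)] r(2) big True by linarith
    qed
    then obtain m where m: "(d + 1) * m \<le> n" "4 * int n - 20 * int m \<le> (\<Sum>p\<in>pverts G. int (card (N2 p)))"
      using sum_N2_bound[OF True] snake_graph_if_snake peanut_graph_if_peanut assms(5,7,8) by metis
    have "real ((d + 1) * m) \<le> real n" using m(1) by (simp only: of_nat_le_iff)
    moreover have "real_of_int (4 * int n - 20 * int m) \<le> real_of_int (\<Sum>p\<in>pverts G. int (card (N2 p)))"
      using m(2) by (simp only: of_int_le_iff)
    ultimately show ?thesis using big True by (intro deficit_bound[where m = "real m"]) (simp_all add: algebra_simps)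
  next
    case False
    \<comment> \<open>The bracket is \<open>0\<close> for \<open>d = 7\<close> and
      \<open>8 / 45\<close> for \<open>d = 8\<close>, so the left side is below \<open>n\<close> in
      both cases.\<close>
    then have "d = 7 \<or> d = 8" using assms(1) by linarith
    moreover have "(\<Sum>u\<in>pverts G. 1) \<le> ?F"
      using N2_nonempty big assms(1,5) by (intro sum_mono) simp
    then have "real n \<le> ?F" using assms(5) by simp
    moreover have "0 < n" using big by simp
    ultimately show ?thesis by auto
  qed
  then have "2 * (2 * real n * (1 - 2 / (real d + 1) - 3 / (real d - 3)))
      < 2 * (real (num_edges (square G)) - real (num_edges G))"
    unfolding num_edges_square[OF assms(2)] by simp
  then show ?thesis by simp
qed

end
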